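(* Let $K$ be a field, $n\ge 1$, and let $\mathbb{S}_n$ be the algebra of one-sided inverses. With the notation of the context: 1. ${}'Q(\mathbb{S}_n)\simeq K(y_1,\ldots,y_n)$, the field of rational functions in $n$ variables. 2. ${}'\mathbb{Y}_n\in \mathrm{Den}_l(\mathbb{S}_n,\mathfrak{a}_n)$ and ${}'\mathbb{Y}_n^{-1}\mathbb{S}_n\simeq {}'Q(\mathbb{S}_n)$. Furthermore, the subset ${}'\mathbb{Y}_n$ of $\mathbb{Y}_n$ is a left denominator set of $\mathbb{S}_n$ which is the largest left denominator set of $\mathbb{S}_n$ that is contained in the multiplicative set $\mathbb{Y}_n\cap {}'\mathcal{C}_{\mathbb{S}_n}$. 3. $\mathcal{S},\mathcal{T}\in \mathrm{Den}_l(\mathbb{S}_n,\mathfrak{a}_n)$ and ${}'\mathbb{Y}_n^{-1}\mathbb{S}_n\simeq \mathcal{T}^{-1}\mathbb{S}_n\simeq \mathcal{S}^{-1}\mathbb{S}_n\simeq K(y_1,\ldots,y_n)$.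
   Context: Localization. All rings are unital. A subset $S$ of a ring $R$ is multiplicative if $1\in S$, $SS\subseteq S$, $0\notin S$. A multiplicative set $S$ is a left Ore set if $Sr\cap Rs\neq\emptyset$ for all $r\in R$, $s\in S$; put $\mathrm{ass}_l(S)=\{r\in R\mid sr=0\text{ for some }s\in S\}$. A left Ore set $S$ is a left denominator set if $rs=0$ with $r\in R$, $s\in S$ implies $tr=0$ for some $t\in S$. $\mathrm{Den}_l(R,\mathfrak{a})$ is the set of left denominator sets $S$ of $R$ with $\mathrm{ass}_l(S)=\mathfrak{a}$, and $S^{-1}R$ is the left localization. ${}'\mathcal{C}_R=\{c\in R\mid rc=0\Rightarrow r=0\}$ is the set of left regular elements of $R$. It contains a largest (with respect to inclusion) left denominator set of $R$, denoted ${}'S(R)$, and ${}'Q(R):={}'S(R)^{-1}R$ is the left regular left quotient ring of $R$. The symbol $\simeq$ denotes isomorphism of $K$-algebras. The algebra $\mathbb{S}_n$. $\mathbb{S}_n$ is the $K$-algebra generated by $x_1,\ldots,x_n,y_1,\ldots,y_n$ subject to the relations $y_ix_i=1$ for all $i$ and $[x_i,y_j]=[x_i,x_j]=[y_i,y_j]=0$ for all $i\ne j$; it has $K$-basis $x^\alpha y^\beta$ ($\alpha,\beta\in\mathbb{N}^n$), and $\mathbb{S}_n\simeq\mathbb{S}_1^{\otimes n}$. $\mathbb{Y}_n=K[y_1,\ldots,y_n]\subseteq\mathbb{S}_n$ is a polynomial algebra. $\mathfrak{a}_n=\mathfrak{p}_1+\cdots+\mathfrak{p}_n$, where $\mathfrak{p}_i$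 is the ideal of $\mathbb{S}_n$ generated by $1-x_iy_i$; then $\mathbb{S}_n/\mathfrak{a}_n= L_n:=K[x_1^{\pm1},\ldots,x_n^{\pm 1}]$ (Laurent polynomials) via $x_i\mapsto x_i$, $y_i\mapsto x_i^{-1}$. Let $\pi_{\mathfrak{a}_n}:\mathbb{S}_n\to \mathbb{S}_n/\mathfrak{a}_n=L_n$ be the canonical map (it is injective on $\mathbb{Y}_n$, and $\mathbb{Y}_n$ is identified with its image in $L_n$). Sets: ${}'\mathbb{Y}_n:=\mathbb{Y}_n\cap {}'S(\mathbb{S}_n)$; $\mathcal{T}:=\pi_{\mathfrak{a}_n}^{-1}(L_n\setminus\{0\})=\mathbb{S}_n\setminus\mathfrak{a}_n$; $\mathcal{S}:=\pi_{\mathfrak{a}_n}^{-1}(\mathbb{Y}_n\setminus\{0\})=(\mathbb{Y}_n\setminus\{0\})+\mathfrak{a}_n$. *)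

theory Defs
  imports "HOL-Algebra.Algebra" "HOL-Algebra.Algebraic_Closure_Type" "HOL-Library.Poly_Mapping"
    "HOL-Computational_Algebra.Fraction_Field"
begin

section \<open>Algebras over a field and their isomorphisms\<close>

text \<open>
  The base field is a type of class \<^class>\<open>field\<close>.  A (not necessarily commutative) unital
  \<open>K\<close>-algebra is a ring record together with the scalar multiplication of the record type
  \<^typ>\<open>('k, 'a) module\<close>.  The ring-theoretic notions below only use the ring part.
\<close>

definition algebra_iso :: "('k, 'a, 'm) module_scheme \<Rightarrow> ('k, 'b, 'p) module_scheme \<Rightarrow> bool"
    (infix \<open>\<simeq>\<^sub>K\<close> 50) where
  "A \<simeq>\<^sub>K B \<longleftrightarrow>
    (\<exists>h \<in> ring_iso A B. \<forall>k. \<forall>a \<in> carrier A. h (k \<odot>\<^bsub>A\<^esub> a) = k \<odot>\<^bsub>B\<^esub> h a)"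

definition quotient_algebra :: "('k, 'a, 'm) module_scheme \<Rightarrow> 'a set \<Rightarrow> ('k, 'a set) module" where
  "quotient_algebra A I = ring.extend (A Quot I)
    (module.fields (\<lambda>k C. \<Union>c \<in> C. I +>\<^bsub>A\<^esub> (k \<odot>\<^bsub>A\<^esub> c)))"


section \<open>Left localization\<close>

definition multiplicative_set :: "('a, 'm) ring_scheme \<Rightarrow> 'a set \<Rightarrow> bool" where
  "multiplicative_set R S \<longleftrightarrow> S \<subseteq> carrier R \<and> \<one>\<^bsub>R\<^esub> \<in> S \<and>
    (\<forall>s \<in> S. \<forall>t \<in> S. s \<otimes>\<^bsub>R\<^esub> t \<in> S) \<and> \<zero>\<^bsub>R\<^esub> \<notin> S"

definition left_Ore_set :: "('a, 'm) ring_scheme \<Rightarrow> 'a set \<Rightarrow> bool" where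
  "left_Ore_set R S \<longleftrightarrow> multiplicative_set R S \<and>
    (\<forall>r \<in> carrier R. \<forall>s \<in> S. {t \<otimes>\<^bsub>R\<^esub> r | t. t \<in> S} \<inter> {a \<otimes>\<^bsub>R\<^esub> s | a. a \<in> carrier R} \<noteq> {})"

definition ass_l :: "('a, 'm) ring_scheme \<Rightarrow> 'a set \<Rightarrow> 'a set" where
  "ass_l R S = {r \<in> carrier R. \<exists>s \<in> S. s \<otimes>\<^bsub>R\<^esub> r = \<zero>\<^bsub>R\<^esub>}"

definition left_denominator_set :: "('a, 'm) ring_scheme \<Rightarrow> 'a set \<Rightarrow> bool" where
  "left_denominator_set R S \<longleftrightarrow> left_Ore_set R S \<and>
    (\<forall>r \<in> carrier R. \<forall>s \<in> S. r \<otimes>\<^bsub>R\<^esub> s = \<zero>\<^bsub>R\<^esub> \<longrightarrow> (\<exists>t \<in> S. t \<otimes>\<^bsub>R\<^esub> r = \<zero>\<^bsub>R\<^esub>))"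

definition Den_l :: "('a, 'm) ring_scheme \<Rightarrow> 'a set \<Rightarrow> 'a set set" where
  "Den_l R I = {S. left_denominator_set R S \<and> ass_l R S = I}"

text \<open>
  The left fraction \<open>s\<^sup>-\<^sup>1 r\<close> is the class of the pair \<open>(s, r)\<close> in \<open>S \<times> R\<close>, where
  \<open>s\<^sup>-\<^sup>1 r = s'\<^sup>-\<^sup>1 r'\<close> iff the two fractions have a common expansion.
\<close>

definition left_fraction :: "('a, 'm) ring_scheme \<Rightarrow> 'a set \<Rightarrow> 'a \<Rightarrow> 'a \<Rightarrow> ('a \<times> 'a) set" where
  "left_fraction R S s r = {(s', r') \<in> S \<times> carrier R.
    \<exists>c \<in> carrier R. \<exists>d \<in> carrier R. c \<otimes>\<^bsub>R\<^esub> s = d \<otimes>\<^bsub>R\<^esub> s' \<and> c \<otimes>\<^bsub>R\<^esub> s \<in> S \<and>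
      c \<otimes>\<^bsub>R\<^esub> r = d \<otimes>\<^bsub>R\<^esub> r'}"

text \<open>
  Multiplication: \<open>(s\<^sub>1\<^sup>-\<^sup>1 r\<^sub>1) (s\<^sub>2\<^sup>-\<^sup>1 r\<^sub>2) = (t s\<^sub>1)\<^sup>-\<^sup>1 (a r\<^sub>2)\<close> whenever \<open>t r\<^sub>1 = a s\<^sub>2\<close> with
  \<open>t \<in> S\<close>, \<open>a \<in> R\<close>.  Addition: \<open>s\<^sub>1\<^sup>-\<^sup>1 r\<^sub>1 + s\<^sub>2\<^sup>-\<^sup>1 r\<^sub>2 = (c s\<^sub>1)\<^sup>-\<^sup>1 (c r\<^sub>1 + d r\<^sub>2)\<close> whenever
  \<open>c s\<^sub>1 = d s\<^sub>2 \<in> S\<close>.  For a left denominator set all these choices exist and give the same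
  class, so the unions below are unions of copies of a single class (as in the library's
  \<^const>\<open>rcoset_mult\<close>).
\<close>

definition left_localization ::
    "('k, 'a, 'm) module_scheme \<Rightarrow> 'a set \<Rightarrow> ('k, ('a \<times> 'a) set) module" where
  "left_localization R S = \<lparr>
    carrier = {left_fraction R S s r | s r. s \<in> S \<and> r \<in> carrier R},
    monoid.mult = (\<lambda>A B. \<Union> {left_fraction R S (t \<otimes>\<^bsub>R\<^esub> s\<^sub>1) (a \<otimes>\<^bsub>R\<^esub> r\<^sub>2) | s\<^sub>1 r\<^sub>1 s\<^sub>2 r\<^sub>2 t a.
      (s\<^sub>1, r\<^sub>1) \<in> A \<and> (s\<^sub>2, r\<^sub>2) \<in> B \<and> t \<in> S \<and> a \<in> carrier R \<and> t \<otimes>\<^bsub>R\<^esub> r\<^sub>1 = a \<otimes>\<^bsub>R\<^esub> s\<^sub>2}),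
    one = left_fraction R S \<one>\<^bsub>R\<^esub> \<one>\<^bsub>R\<^esub>,
    ring.zero = left_fraction R S \<one>\<^bsub>R\<^esub> \<zero>\<^bsub>R\<^esub>,
    add = (\<lambda>A B. \<Union> {left_fraction R S (c \<otimes>\<^bsub>R\<^esub> s\<^sub>1) (c \<otimes>\<^bsub>R\<^esub> r\<^sub>1 \<oplus>\<^bsub>R\<^esub> d \<otimes>\<^bsub>R\<^esub> r\<^sub>2) | s\<^sub>1 r\<^sub>1 s\<^sub>2 r\<^sub>2 c d.
      (s\<^sub>1, r\<^sub>1) \<in> A \<and> (s\<^sub>2, r\<^sub>2) \<in> B \<and> c \<in> carrier R \<and> d \<in> carrier R \<and>
      c \<otimes>\<^bsub>R\<^esub> s\<^sub>1 = d \<otimes>\<^bsub>R\<^esub> s\<^sub>2 \<and> c \<otimes>\<^bsub>R\<^esub> s\<^sub>1 \<in> S}),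
    module.smult = (\<lambda>k A. \<Union> {left_fraction R S s (k \<odot>\<^bsub>R\<^esub> r) | s r. (s, r) \<in> A}) \<rparr>"

definition left_regular :: "('a, 'm) ring_scheme \<Rightarrow> 'a set" where
  "left_regular R =
    {c \<in> carrier R. \<forall>r \<in> carrier R. r \<otimes>\<^bsub>R\<^esub> c = \<zero>\<^bsub>R\<^esub> \<longrightarrow> r = \<zero>\<^bsub>R\<^esub>}"

text \<open>
  The greatest element, with respect to inclusion, among the left denominator sets contained in
  \<^term>\<open>left_regular R\<close>.
\<close>

definition largest_left_regular_denominator_set :: "('a, 'm) ring_scheme \<Rightarrow> 'a set" where
  "largest_left_regular_denominator_set R =
    (GREATEST S. left_denominator_set R S \<and> S \<subseteq> left_regular R)"

definition left_regular_left_quotient_ring ::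
    "('k, 'a, 'm) module_scheme \<Rightarrow> ('k, ('a \<times> 'a) set) module" where
  "left_regular_left_quotient_ring R =
    left_localization R (largest_left_regular_denominator_set R)"


section \<open>Free algebras\<close>

text \<open>
  The free algebra on a type of generators is the monoid algebra of the free monoid, written
  additively because the product of \<^typ>\<open>'a \<Rightarrow>\<^sub>0 'b\<close> is the convolution over an
  additive monoid.
\<close>

datatype 'g free_monoid = Word (letters: "'g list")

instantiation free_monoid :: (type) monoid_add
begin

definition zero_free_monoid :: "'a free_monoid" where
  "0 = Word []"

definition plus_free_monoid :: "'a free_monoid \<Rightarrow> 'a free_monoid \<Rightarrow> 'a free_monoid" where
  "u + v = Word (letters u @ letters v)"

instance
  by standard (simp_all add: zero_free_monoid_def plus_free_monoid_def)

end

definition free_algebra :: "('k::field, 'g free_monoid \<Rightarrow>\<^sub>0 'k) module" where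
  "free_algebra = ring.extend ring_of_type_algebra
    (module.fields (\<lambda>k p. Poly_Mapping.single 0 k * p))"

definition free_gen :: "'g \<Rightarrow> ('g free_monoid \<Rightarrow>\<^sub>0 'k::field)" where
  "free_gen g = Poly_Mapping.single (Word [g]) 1"


section \<open>The algebra of one-sided inverses\<close>

text \<open>
  The indices \<open>1, \<dots>, n\<close> are the elements of a finite linearly ordered type \<^typ>\<open>'n\<close>, so that
  \<open>n = CARD('n) \<ge> 1\<close>; the order is only needed for the library instance making polynomials in
  variables from \<^typ>\<open>'n\<close> an integral domain.  The arguments of type \<^typ>\<open>'n itself\<close> and
  \<^typ>\<open>'k itself\<close> only carry the index type and the base field.
\<close>

datatype 'n gen = gen_x 'n | gen_y 'n

type_synonym ('n, 'k) one_sided_inverses = "('n gen free_monoid \<Rightarrow>\<^sub>0 'k) set"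

definition relators :: "('n gen free_monoid \<Rightarrow>\<^sub>0 'k::field) set" where
  "relators =
    {free_gen (gen_y i) * free_gen (gen_x i) - 1 | i. True} \<union>
    {free_gen (gen_x i) * free_gen (gen_y j) - free_gen (gen_y j) * free_gen (gen_x i) | i j. i \<noteq> j} \<union>
    {free_gen (gen_x i) * free_gen (gen_x j) - free_gen (gen_x j) * free_gen (gen_x i) | i j. i \<noteq> j} \<union>
    {free_gen (gen_y i) * free_gen (gen_y j) - free_gen (gen_y j) * free_gen (gen_y i) | i j. i \<noteq> j}"

definition SS :: "'n::{finite,linorder} itself \<Rightarrow> 'k::field itself \<Rightarrow>
    ('k, ('n, 'k) one_sided_inverses) module" where
  "SS N K = quotient_algebra free_algebra (Idl\<^bsub>free_algebra\<^esub> relators)"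

definition SS_gen :: "'n::{finite,linorder} gen \<Rightarrow> ('n, 'k::field) one_sided_inverses" where
  "SS_gen g = (Idl\<^bsub>free_algebra\<^esub> relators) +>\<^bsub>free_algebra\<^esub> free_gen g"

definition YY :: "'n::{finite,linorder} itself \<Rightarrow> 'k::field itself \<Rightarrow>
    ('n, 'k) one_sided_inverses set" where
  "YY N K = generate_ring (SS N K)
    ({k \<odot>\<^bsub>SS N K\<^esub> \<one>\<^bsub>SS N K\<^esub> | k. True} \<union> {SS_gen (gen_y i) | i. True})"

definition pp :: "'n::{finite,linorder} itself \<Rightarrow> 'k::field itself \<Rightarrow> 'n \<Rightarrow>
    ('n, 'k) one_sided_inverses set" where
  "pp N K i = Idl\<^bsub>SS N K\<^esub> {\<one>\<^bsub>SS N K\<^esub> \<ominus>\<^bsub>SS N K\<^esub> SS_gen (gen_x i) \<otimes>\<^bsub>SS N K\<^esub> SS_gen (gen_y i)}"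

definition aa :: "'n::{finite,linorder} itself \<Rightarrow> 'k::field itself \<Rightarrow>
    ('n, 'k) one_sided_inverses set" where
  "aa N K = {\<Oplus>\<^bsub>SS N K\<^esub>i\<in>UNIV. f i | f. \<forall>i. f i \<in> pp N K i}"

text \<open>
  The canonical map of \<open>SS\<close> onto \<open>L = SS / aa\<close>.  In \<open>S_set\<close> below, \<open>YY\<close> is identified with its
  image under this map.
\<close>

definition proj_aa :: "'n::{finite,linorder} itself \<Rightarrow> 'k::field itself \<Rightarrow>
    ('n, 'k) one_sided_inverses \<Rightarrow> ('n, 'k) one_sided_inverses set" where
  "proj_aa N K s = aa N K +>\<^bsub>SS N K\<^esub> s"

definition YY' :: "'n::{finite,linorder} itself \<Rightarrow> 'k::field itself \<Rightarrow>
    ('n, 'k) one_sided_inverses set" where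
  "YY' N K = YY N K \<inter> largest_left_regular_denominator_set (SS N K)"

definition T_set :: "'n::{finite,linorder} itself \<Rightarrow> 'k::field itself \<Rightarrow>
    ('n, 'k) one_sided_inverses set" where
  "T_set N K = {s \<in> carrier (SS N K). proj_aa N K s \<in>
    carrier (quotient_algebra (SS N K) (aa N K)) - {\<zero>\<^bsub>quotient_algebra (SS N K) (aa N K)\<^esub>}}"

definition S_set :: "'n::{finite,linorder} itself \<Rightarrow> 'k::field itself \<Rightarrow>
    ('n, 'k) one_sided_inverses set" where
  "S_set N K = {s \<in> carrier (SS N K). proj_aa N K s \<in>
    proj_aa N K ` (YY N K - {\<zero>\<^bsub>SS N K\<^esub>})}"


section \<open>Rational functions\<close>

definition rational_functions :: "'n::{finite,linorder} itself \<Rightarrow> 'k::field itself \<Rightarrow>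
    ('k, (('n \<Rightarrow>\<^sub>0 nat) \<Rightarrow>\<^sub>0 'k) fract) module" where
  "rational_functions N K = ring.extend ring_of_type_algebra
    (module.fields (\<lambda>k q. Fract (Poly_Mapping.single 0 k) 1 * q))"

section \<open>Basic facts\<close>

lemma ring_free_algebra: "ring (free_algebra :: ('k::field, 'g free_monoid \<Rightarrow>\<^sub>0 'k) module)"
proof -
  have "\<exists>y. x + y = 0 \<and> y + x = 0" for x :: "'g free_monoid \<Rightarrow>\<^sub>0 'k"
    by (rule exI[of _ "- x"]) simp
  then show ?thesis
    by unfold_locales
      (auto simp: free_algebra_def ring_of_type_algebra_def ring.defs module.defs Units_def algebra_simps)
qed

lemma carrier_free_algebra: "carrier free_algebra = UNIV"
  by (simp add: free_algebra_def ring_of_type_algebra_def ring.defs module.defs)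

lemma ideal_relators: "ideal (Idl\<^bsub>free_algebra\<^esub> relators) free_algebra"
  by (rule ring.genideal_ideal[OF ring_free_algebra]) (simp add: carrier_free_algebra)

lemma quotient_algebra_simps [simp]:
  "carrier (quotient_algebra A I) = carrier (A Quot I)"
  "monoid.mult (quotient_algebra A I) = monoid.mult (A Quot I)"
  "monoid.one (quotient_algebra A I) = monoid.one (A Quot I)"
  "ring.zero (quotient_algebra A I) = ring.zero (A Quot I)"
  "ring.add (quotient_algebra A I) = ring.add (A Quot I)"
  by (simp_all add: quotient_algebra_def ring.defs module.defs)

lemma ring_cong:
  assumes "ring A" "carrier B = carrier A" "monoid.mult B = monoid.mult A" "monoid.one B = monoid.one A"
    "ring.zero B = ring.zero A" "ring.add B = ring.add A"
  shows "ring B"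
proof -
  interpret ring A by fact
  show ?thesis
    by (rule ringI; (rule abelian_groupI monoidI)?)
       (auto simp: assms a_ac m_assoc l_distr r_distr intro: l_neg dest: a_inv_closed) 
qed

lemma ring_SS: "ring (SS N K)"
  unfolding SS_def
  by (rule ring_cong[OF ideal.quotient_is_ring[OF ideal_relators]]) auto

lemma SS_gen_closed: "SS_gen g \<in> carrier (SS N K)"
  unfolding SS_def SS_gen_def
  by (auto simp: FactRing_def A_RCOSETS_def' carrier_free_algebra)


lemma relator_in: "r \<in> relators \<Longrightarrow> r \<in> Idl\<^bsub>free_algebra\<^esub> relators"
  using ring.genideal_self[OF ring_free_algebra, of relators] by (auto simp: carrier_free_algebra)

lemma SS_rel:
  fixes N :: "'n::{finite,linorder} itself" and K :: "'k::field itself"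
  shows "SS_gen (gen_y i) \<otimes>\<^bsub>SS N K\<^esub> SS_gen (gen_x i) = \<one>\<^bsub>SS N K\<^esub>"
proof -
  interpret F: ring free_algebra by (rule ring_free_algebra)
  let ?I = "Idl\<^bsub>free_algebra\<^esub> (relators :: ('n gen free_monoid \<Rightarrow>\<^sub>0 'k) set)"
  have mul: "x \<otimes>\<^bsub>free_algebra\<^esub> y = x * y" for x y :: "'n gen free_monoid \<Rightarrow>\<^sub>0 'k"
    by (simp add: free_algebra_def ring_of_type_algebra_def ring.defs module.defs)
  have on: "\<one>\<^bsub>free_algebra\<^esub> = (1 :: 'n gen free_monoid \<Rightarrow>\<^sub>0 'k)"
    by (simp add: free_algebra_def ring_of_type_algebra_def ring.defs module.defs)
  have add: "x \<oplus>\<^bsub>free_algebra\<^esub> y = x + y" for x y :: "'n gen free_monoid \<Rightarrow>\<^sub>0 'k"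
    by (simp add: free_algebra_def ring_of_type_algebra_def ring.defs module.defs)
  have "free_gen (gen_y i) * free_gen (gen_x i) - 1 \<in> ?I"
    by (rule relator_in) (auto simp: relators_def)
  then have "free_gen (gen_y i) * free_gen (gen_x i) \<in> ?I +>\<^bsub>free_algebra\<^esub> 1"
    unfolding a_r_coset_def' add by force
  then have "?I +>\<^bsub>free_algebra\<^esub> 1 = ?I +>\<^bsub>free_algebra\<^esub> (free_gen (gen_y i) * free_gen (gen_x i))"
    using F.a_repr_independence additive_subgroup.a_subgroup[OF ideal.axioms(1)[OF ideal_relators]]
    by (metis UNIV_I carrier_free_algebra)
  then show ?thesis
    by (simp add: SS_def SS_gen_def FactRing_def ideal.rcoset_mult_add[OF ideal_relators] carrier_free_algebra mul on)
qed

lemma ideal_pp: "ideal (pp N K i) (SS N K)"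
proof -
  interpret ring "SS N K" by (rule ring_SS)
  show ?thesis
    unfolding pp_def by (rule genideal_ideal) (simp add: SS_gen_closed)
qed

lemma aa_sub: "aa N K \<subseteq> carrier (SS N K)"
proof -
  interpret ring "SS N K" by (rule ring_SS)
  have "pp N K i \<subseteq> carrier (SS N K)" for i
    using ideal_pp ideal.axioms(1) additive_subgroup.a_subset by blast
  then show ?thesis
    by (auto simp: aa_def intro!: finsum_closed)
qed

lemma aaI: "(\<And>i. f i \<in> pp N K i) \<Longrightarrow> (\<Oplus>\<^bsub>SS N K\<^esub>i\<in>UNIV. f i) \<in> aa N K"
  unfolding aa_def by blast

lemma aaE:
  assumes "a \<in> aa N K"
  shows "\<exists>f. (\<forall>i. f i \<in> pp N K i) \<and> a = (\<Oplus>\<^bsub>SS N K\<^esub>i\<in>UNIV. f i)"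
  using assms unfolding aa_def by auto

lemma ideal_aa:
  fixes N :: "'n::{finite,linorder} itself" and K :: "'k::field itself"
  shows "ideal (aa N K) (SS N K)"
proof -
  interpret ring "SS N K" by (rule ring_SS)
  have ppc: "u \<in> carrier (SS N K)" if "u \<in> pp N K i" for u i
    using ideal.Icarr[OF ideal_pp that] .
  have L: "x \<otimes>\<^bsub>SS N K\<^esub> a \<in> aa N K" if a: "a \<in> aa N K" and x: "x \<in> carrier (SS N K)" for a x
  proof -
    obtain f where f': "\<forall>i. f i \<in> pp N K i" and f2: "a = (\<Oplus>\<^bsub>SS N K\<^esub>i\<in>UNIV. f i)"
      using aaE[OF a] by auto
    note f = f'[rule_format] f2
    have "x \<otimes>\<^bsub>SS N K\<^esub> a = (\<Oplus>\<^bsub>SS N K\<^esub>i\<in>UNIV. x \<otimes>\<^bsub>SS N K\<^esub> f i)"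
      unfolding f(2) using ppc[OF f(1)] x by (intro finsum_rdistr) auto
    then show ?thesis
      by (simp only:) (intro aaI ideal.I_l_closed[OF ideal_pp] f x)
  qed
  have R: "a \<otimes>\<^bsub>SS N K\<^esub> x \<in> aa N K" if a: "a \<in> aa N K" and x: "x \<in> carrier (SS N K)" for a x
  proof -
    obtain f where f': "\<forall>i. f i \<in> pp N K i" and f2: "a = (\<Oplus>\<^bsub>SS N K\<^esub>i\<in>UNIV. f i)"
      using aaE[OF a] by auto
    note f = f'[rule_format] f2
    have "a \<otimes>\<^bsub>SS N K\<^esub> x = (\<Oplus>\<^bsub>SS N K\<^esub>i\<in>UNIV. f i \<otimes>\<^bsub>SS N K\<^esub> x)"
      unfolding f(2) using ppc[OF f(1)] x by (intro finsum_ldistr) auto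
    then show ?thesis
      by (simp only:) (intro aaI ideal.I_r_closed[OF ideal_pp] f x)
  qed
  show ?thesis
  proof (rule idealI)
    show "ring (SS N K)" by (rule ring_SS)
    show "subgroup (aa N K) (add_monoid (SS N K))"
    proof (rule add.subgroupI)
      show "aa N K \<subseteq> carrier (SS N K)" by (rule aa_sub)
      have "(\<Oplus>\<^bsub>SS N K\<^esub>i\<in>(UNIV::'n set). \<zero>\<^bsub>SS N K\<^esub>) \<in> aa N K"
        by (rule aaI) (rule additive_subgroup.zero_closed[OF ideal.axioms(1)[OF ideal_pp]])
      then show "aa N K \<noteq> {}" by blast
    next
      fix a assume a: "a \<in> aa N K"
      then have "a \<in> carrier (SS N K)" using aa_sub by blast
      then have "\<ominus>\<^bsub>SS N K\<^esub> a = (\<ominus>\<^bsub>SS N K\<^esub> \<one>\<^bsub>SS N K\<^esub>) \<otimes>\<^bsub>SS N K\<^esub> a"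
        by (simp add: l_minus)
      then show "\<ominus>\<^bsub>SS N K\<^esub> a \<in> aa N K"
        using L[OF a, of "\<ominus>\<^bsub>SS N K\<^esub> \<one>\<^bsub>SS N K\<^esub>"] by simp
    next
      fix a b assume a: "a \<in> aa N K" and b: "b \<in> aa N K"
      obtain f where f': "\<forall>i. f i \<in> pp N K i" and f2: "a = (\<Oplus>\<^bsub>SS N K\<^esub>i\<in>UNIV. f i)"
      using aaE[OF a] by auto
    note f = f'[rule_format] f2
      obtain g where g': "\<forall>i. g i \<in> pp N K i" and g2: "b = (\<Oplus>\<^bsub>SS N K\<^esub>i\<in>UNIV. g i)"
      using aaE[OF b] by auto
    note g = g'[rule_format] g2
      have "a \<oplus>\<^bsub>SS N K\<^esub> b = (\<Oplus>\<^bsub>SS N K\<^esub>i\<in>UNIV. f i \<oplus>\<^bsub>SS N K\<^esub> g i)"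
        unfolding f(2) g(2) using ppc[OF f(1)] ppc[OF g(1)]
        by (intro finsum_addf[symmetric]) auto
      then show "a \<oplus>\<^bsub>SS N K\<^esub> b \<in> aa N K"
        by (simp only:) (intro aaI additive_subgroup.a_closed[OF ideal.axioms(1)[OF ideal_pp]] f g)
    qed
  qed (fact L R)+
qed

lemma T_set_eq: "T_set N K = carrier (SS N K) - aa N K"
proof -
  interpret I: ideal "aa N K" "SS N K" by (rule ideal_aa)
  have "aa N K +>\<^bsub>SS N K\<^esub> s = aa N K \<longleftrightarrow> s \<in> aa N K" if "s \<in> carrier (SS N K)" for s
    using that I.a_coset_join1 I.a_coset_join2 I.is_additive_subgroup
    by (metis I.a_rcos_const I.a_rcos_self abelian_subgroup.a_rcos_self)
  then show ?thesis
    by (auto simp: T_set_def proj_aa_def FactRing_def A_RCOSETS_def')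
qed


lemma smult_closed_SS:
  fixes N :: "'n::{finite,linorder} itself" and K :: "'k::field itself"
  assumes "C \<in> carrier (SS N K)"
  shows "k \<odot>\<^bsub>SS N K\<^esub> C \<in> carrier (SS N K)"
proof -
  let ?F = "free_algebra :: ('k, 'n gen free_monoid \<Rightarrow>\<^sub>0 'k) module"
  let ?I = "Idl\<^bsub>?F\<^esub> relators"
  interpret I: ideal ?I ?F by (rule ideal_relators)
  have mul: "k \<odot>\<^bsub>?F\<^esub> y = Poly_Mapping.single 0 k \<otimes>\<^bsub>?F\<^esub> y" for y
    by (simp add: free_algebra_def ring_of_type_algebra_def ring.defs module.defs)
  obtain a where a: "a \<in> carrier ?F" "C = ?I +>\<^bsub>?F\<^esub> a"
    using assms by (auto simp: SS_def FactRing_def A_RCOSETS_def')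
  have k: "Poly_Mapping.single 0 k \<in> carrier ?F" by (simp add: carrier_free_algebra)
  have "?I +>\<^bsub>?F\<^esub> (k \<odot>\<^bsub>?F\<^esub> c) = ?I +>\<^bsub>?F\<^esub> (k \<odot>\<^bsub>?F\<^esub> a)" if "c \<in> C" for c
  proof -
    have c: "c \<in> carrier ?F" by (simp add: carrier_free_algebra)
    have "?I +>\<^bsub>?F\<^esub> a = ?I +>\<^bsub>?F\<^esub> c"
      using I.a_repr_independence[OF _ a(1) I.a_subgroup, of c] that a(2) by simp
    from arg_cong[OF this, of "rcoset_mult ?F ?I (?I +>\<^bsub>?F\<^esub> Poly_Mapping.single 0 k)"]
    show ?thesis
      unfolding mul I.rcoset_mult_add[OF k c] I.rcoset_mult_add[OF k a(1)] by (rule sym)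
  qed
  then have "(\<Union>c \<in> C. ?I +>\<^bsub>?F\<^esub> (k \<odot>\<^bsub>?F\<^esub> c)) = ?I +>\<^bsub>?F\<^esub> (k \<odot>\<^bsub>?F\<^esub> a)"
    using I.a_rcos_self[OF a(1)] unfolding a(2) by blast
  moreover have "k \<odot>\<^bsub>SS N K\<^esub> C = (\<Union>c \<in> C. ?I +>\<^bsub>?F\<^esub> (k \<odot>\<^bsub>?F\<^esub> c))"
    unfolding SS_def quotient_algebra_def ring.defs module.defs by simp
  moreover have "k \<odot>\<^bsub>?F\<^esub> a \<in> carrier ?F" by (simp add: carrier_free_algebra)
  ultimately show ?thesis
    unfolding SS_def quotient_algebra_simps FactRing_def A_RCOSETS_def' by (simp only: partial_object.simps) blast
qed

lemma YY_sub: "YY N K \<subseteq> carrier (SS N K)"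
proof -
  interpret ring "SS N K" by (rule ring_SS)
  show ?thesis
    unfolding YY_def
    by (rule generate_ring_incl) (use SS_gen_closed smult_closed_SS[OF one_closed] in blast)
qed

lemma S_set_eq: "S_set N K = (YY N K - {\<zero>\<^bsub>SS N K\<^esub>}) <+>\<^bsub>SS N K\<^esub> aa N K"
proof -
  interpret I: ideal "aa N K" "SS N K" by (rule ideal_aa)
  have "s \<in> S_set N K \<longleftrightarrow> s \<in> (YY N K - {\<zero>\<^bsub>SS N K\<^esub>}) <+>\<^bsub>SS N K\<^esub> aa N K" for s
  proof
    assume "s \<in> S_set N K"
    then obtain y where y: "s \<in> carrier (SS N K)" "y \<in> YY N K - {\<zero>\<^bsub>SS N K\<^esub>}"
      "aa N K +>\<^bsub>SS N K\<^esub> s = aa N K +>\<^bsub>SS N K\<^esub> y"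
      by (auto simp: S_set_def proj_aa_def)
    then have "s \<in> aa N K +>\<^bsub>SS N K\<^esub> y" using I.a_rcos_self by metis
    then obtain a where "a \<in> aa N K" "s = a \<oplus>\<^bsub>SS N K\<^esub> y"
      by (auto simp: a_r_coset_def')
    then show "s \<in> (YY N K - {\<zero>\<^bsub>SS N K\<^esub>}) <+>\<^bsub>SS N K\<^esub> aa N K"
      using y YY_sub[of N K] aa_sub[of N K] I.a_comm[of a y] unfolding set_add_def' by blast
  next
    assume "s \<in> (YY N K - {\<zero>\<^bsub>SS N K\<^esub>}) <+>\<^bsub>SS N K\<^esub> aa N K"
    then obtain y a where y: "y \<in> YY N K - {\<zero>\<^bsub>SS N K\<^esub>}" "a \<in> aa N K" "s = y \<oplus>\<^bsub>SS N K\<^esub> a"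
      by (auto simp: set_add_def')
    have c: "y \<in> carrier (SS N K)" "a \<in> carrier (SS N K)" using y YY_sub[of N K] aa_sub[of N K] by auto
    then have "s \<in> aa N K +>\<^bsub>SS N K\<^esub> y"
      using y(2,3) by (auto simp: a_r_coset_def' I.a_comm)
    then have "aa N K +>\<^bsub>SS N K\<^esub> s = aa N K +>\<^bsub>SS N K\<^esub> y"
      using I.a_repr_independence c additive_subgroup.a_subgroup[OF ideal.axioms(1)[OF ideal_aa]] by metis
    then show "s \<in> S_set N K"
      using y c by (auto simp: S_set_def proj_aa_def)
  qed
  then show ?thesis by blast
qed

text \<open>
  \<^const>\<open>left_localization\<close> has the expected recognition principle: an algebra homomorphism to a
  field with kernel \<^term>\<open>ass_l R S\<close>, such that every element of the field is a left fraction
  with denominator in \<open>S\<close>, induces an isomorphism.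
\<close>

lemma left_localization_iso:
  fixes R :: "('k, 'a, 'm) module_scheme" and F :: "('k, 'f, 'p) module_scheme"
  assumes R: "ring R" and F: "field F" and S: "left_denominator_set R S"
    and h: "h \<in> ring_hom R F" and ker: "\<And>r. r \<in> carrier R \<Longrightarrow> h r = \<zero>\<^bsub>F\<^esub> \<longleftrightarrow> r \<in> ass_l R S"
    and fr: "\<And>q. q \<in> carrier F \<Longrightarrow> \<exists>s\<in>S. \<exists>r\<in>carrier R. h s \<otimes>\<^bsub>F\<^esub> q = h r"
    and sm: "\<And>k r. r \<in> carrier R \<Longrightarrow> k \<odot>\<^bsub>R\<^esub> r \<in> carrier R \<and> h (k \<odot>\<^bsub>R\<^esub> r) = k \<odot>\<^bsub>F\<^esub> h r"
    and sm2: "\<And>k a b. a \<in> carrier F \<Longrightarrow> b \<in> carrier F \<Longrightarrow> a \<otimes>\<^bsub>F\<^esub> (k \<odot>\<^bsub>F\<^esub> b) = k \<odot>\<^bsub>F\<^esub> (a \<otimes>\<^bsub>F\<^esub> b)"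
    and sm3: "\<And>k a. a \<in> carrier F \<Longrightarrow> k \<odot>\<^bsub>F\<^esub> a \<in> carrier F"
  shows "left_localization R S \<simeq>\<^sub>K F"
proof -
  interpret R: ring R by fact
  interpret F: field F by fact
  note ms = S[unfolded left_denominator_set_def left_Ore_set_def multiplicative_set_def]
  have SR: "s \<in> carrier R" if "s \<in> S" for s using that ms by auto
  have h0: "h s \<noteq> \<zero>\<^bsub>F\<^esub>" if sS: "s \<in> S" for s
  proof
    assume "h s = \<zero>\<^bsub>F\<^esub>"
    then obtain t where "t \<in> S" "t \<otimes>\<^bsub>R\<^esub> s = \<zero>\<^bsub>R\<^esub>" using ker[of s] sS SR[of s] unfolding ass_l_def by blast
    then show False using ms sS by metis
  qed
  have hc: "h r \<in> carrier F" if "r \<in> carrier R" for r using ring_hom_closed[OF h that] .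
  have hm: "h (a \<otimes>\<^bsub>R\<^esub> b) = h a \<otimes>\<^bsub>F\<^esub> h b" if "a \<in> carrier R" "b \<in> carrier R" for a b
    using ring_hom_mult[OF h that] .
  have ha: "h (a \<oplus>\<^bsub>R\<^esub> b) = h a \<oplus>\<^bsub>F\<^esub> h b" if "a \<in> carrier R" "b \<in> carrier R" for a b
    using ring_hom_add[OF h that] .
  have h1: "h \<one>\<^bsub>R\<^esub> = \<one>\<^bsub>F\<^esub>" using ring_hom_one[OF h] .
  have hz: "h \<zero>\<^bsub>R\<^esub> = \<zero>\<^bsub>F\<^esub>" using ring_hom_zero[OF h R.ring_axioms F.ring_axioms] .
  have heq: "\<exists>u\<in>S. u \<otimes>\<^bsub>R\<^esub> a = u \<otimes>\<^bsub>R\<^esub> b" if ab: "a \<in> carrier R" "b \<in> carrier R" "h a = h b" for a b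
  proof -
    have "h (a \<ominus>\<^bsub>R\<^esub> b) \<oplus>\<^bsub>F\<^esub> h b = h b"
      using ab ha[of "a \<ominus>\<^bsub>R\<^esub> b" b] by (simp add: R.minus_eq R.add.m_assoc R.l_neg)
    then have "h (a \<ominus>\<^bsub>R\<^esub> b) = \<zero>\<^bsub>F\<^esub>"
      using hc[of b] hc[of "a \<ominus>\<^bsub>R\<^esub> b"] ab by (simp add: F.add.r_cancel_one)
    then obtain u where u: "u \<in> S" "u \<otimes>\<^bsub>R\<^esub> (a \<ominus>\<^bsub>R\<^esub> b) = \<zero>\<^bsub>R\<^esub>"
      using ker[of "a \<ominus>\<^bsub>R\<^esub> b"] ab by (auto simp: ass_l_def)
    have "u \<otimes>\<^bsub>R\<^esub> a = u \<otimes>\<^bsub>R\<^esub> b"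
      using u ab SR[OF u(1)] by (simp add: R.minus_eq R.r_distr R.r_minus) (metis R.minus_equality R.m_closed R.add.inv_closed R.minus_minus)
    then show ?thesis using u by auto
  qed
  define v where "v s r = inv\<^bsub>F\<^esub> (h s) \<otimes>\<^bsub>F\<^esub> h r" for s r
  have U: "h s \<in> Units F" if "s \<in> S" for s using h0[OF that] hc[OF SR[OF that]] by (simp add: F.field_Units)
  have vc: "v s r \<in> carrier F" if "s \<in> S" "r \<in> carrier R" for s r
    using U hc that by (auto simp: v_def)
  have vq: "v s r = q \<longleftrightarrow> h r = h s \<otimes>\<^bsub>F\<^esub> q" if "s \<in> S" "r \<in> carrier R" "q \<in> carrier F" for s r q
    unfolding v_def using that U[OF that(1)] hc F.Units_closed F.Units_inv_closed
    by (smt (verit) F.m_assoc F.Units_l_inv F.Units_r_inv F.l_one)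
  have ex0: "v (c \<otimes>\<^bsub>R\<^esub> s) (c \<otimes>\<^bsub>R\<^esub> r) = v s r"
    if "s \<in> S" "r \<in> carrier R" "c \<in> carrier R" "c \<otimes>\<^bsub>R\<^esub> s \<in> S" for c s r
  proof -
    have e: "h r = h s \<otimes>\<^bsub>F\<^esub> v s r" using vq that vc by metis
    have "h (c \<otimes>\<^bsub>R\<^esub> r) = h (c \<otimes>\<^bsub>R\<^esub> s) \<otimes>\<^bsub>F\<^esub> v s r"
      using that hm[of c r] hm[of c s] e hc SR vc F.m_assoc by metis
    then show ?thesis using that vq vc by (metis R.m_closed)
  qed
  have rel: "(s', r') \<in> left_fraction R S s r \<longleftrightarrow> s' \<in> S \<and> r' \<in> carrier R \<and> v s' r' = v s r"
    if sr: "s \<in> S" "r \<in> carrier R" for s r s' r'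
  proof
    assume "(s', r') \<in> left_fraction R S s r"
    then obtain c d where *: "s' \<in> S" "r' \<in> carrier R" "c \<in> carrier R" "d \<in> carrier R"
      "c \<otimes>\<^bsub>R\<^esub> s = d \<otimes>\<^bsub>R\<^esub> s'" "c \<otimes>\<^bsub>R\<^esub> s \<in> S" "c \<otimes>\<^bsub>R\<^esub> r = d \<otimes>\<^bsub>R\<^esub> r'"
      unfolding left_fraction_def by blast
    have A: "v (c \<otimes>\<^bsub>R\<^esub> s) (c \<otimes>\<^bsub>R\<^esub> r) = v s r" using ex0 * sr by metis
    have B: "v (d \<otimes>\<^bsub>R\<^esub> s') (d \<otimes>\<^bsub>R\<^esub> r') = v s' r'" using ex0 * sr by metis
    show "s' \<in> S \<and> r' \<in> carrier R \<and> v s' r' = v s r" using A B * by metis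
  next
    assume *: "s' \<in> S \<and> r' \<in> carrier R \<and> v s' r' = v s r"
    then have "{t \<otimes>\<^bsub>R\<^esub> s | t. t \<in> S} \<inter> {a \<otimes>\<^bsub>R\<^esub> s' | a. a \<in> carrier R} \<noteq> {}"
      using ms sr by blast
    then obtain t a where ta: "t \<in> S" "a \<in> carrier R" "t \<otimes>\<^bsub>R\<^esub> s = a \<otimes>\<^bsub>R\<^esub> s'" by auto
    have "h (t \<otimes>\<^bsub>R\<^esub> r) = h (a \<otimes>\<^bsub>R\<^esub> r')"
    proof -
      have "h r = h s \<otimes>\<^bsub>F\<^esub> v s r" "h r' = h s' \<otimes>\<^bsub>F\<^esub> v s r"
        using vq[OF sr vc[OF sr]] vq[of s' r' "v s r"] * vc[OF sr] by auto
      moreover have "h t \<otimes>\<^bsub>F\<^esub> h s = h a \<otimes>\<^bsub>F\<^esub> h s'" using ta * sr SR hm by metis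
      ultimately show ?thesis using ta * sr SR hc vc[OF sr] by (simp add: hm F.m_assoc[symmetric])
    qed
    then obtain u where u: "u \<in> S" "u \<otimes>\<^bsub>R\<^esub> (t \<otimes>\<^bsub>R\<^esub> r) = u \<otimes>\<^bsub>R\<^esub> (a \<otimes>\<^bsub>R\<^esub> r')"
      using heq[of "t \<otimes>\<^bsub>R\<^esub> r" "a \<otimes>\<^bsub>R\<^esub> r'"] ta * sr SR by auto
    have "(u \<otimes>\<^bsub>R\<^esub> t) \<otimes>\<^bsub>R\<^esub> s = (u \<otimes>\<^bsub>R\<^esub> a) \<otimes>\<^bsub>R\<^esub> s'" "(u \<otimes>\<^bsub>R\<^esub> t) \<otimes>\<^bsub>R\<^esub> s \<in> S"
      "(u \<otimes>\<^bsub>R\<^esub> t) \<otimes>\<^bsub>R\<^esub> r = (u \<otimes>\<^bsub>R\<^esub> a) \<otimes>\<^bsub>R\<^esub> r'"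
      subgoal using u ta * sr SR by (simp add: R.m_assoc)
      subgoal using u ta * sr ms by metis
      subgoal using u ta * sr SR by (simp add: R.m_assoc)
      done
    moreover have "u \<otimes>\<^bsub>R\<^esub> t \<in> carrier R" "u \<otimes>\<^bsub>R\<^esub> a \<in> carrier R" using u ta SR by auto
    ultimately show "(s', r') \<in> left_fraction R S s r"
      using * unfolding left_fraction_def by blast
  qed
  define C where "C q = {(s, r) \<in> S \<times> carrier R. v s r = q}" for q
  have lf: "left_fraction R S s r = C (v s r)" if "s \<in> S" "r \<in> carrier R" for s r
    using rel[OF that] unfolding C_def by auto
  have Cin: "(s, r) \<in> C q \<longleftrightarrow> s \<in> S \<and> r \<in> carrier R \<and> v s r = q" for s r q
    by (auto simp: C_def)
  have ex: "\<exists>s\<in>S. \<exists>r\<in>carrier R. v s r = q" if "q \<in> carrier F" for q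
    using fr[OF that] vq that by metis
  have injC: "inj_on C (carrier F)"
    by (rule inj_onI) (use ex Cin in blast)
  have car: "carrier (left_localization R S) = C ` carrier F"
    using lf ex vc by (fastforce simp: left_localization_def)
  have eqU: "\<Union>Z = C q" if "Z \<noteq> {}" "\<And>x. x \<in> Z \<Longrightarrow> x = C q" for Z q using that by blast
  have mult: "C p \<otimes>\<^bsub>left_localization R S\<^esub> C q = C (p \<otimes>\<^bsub>F\<^esub> q)" if pq: "p \<in> carrier F" "q \<in> carrier F" for p q
  proof -
    obtain s1 r1 where 1: "s1 \<in> S" "r1 \<in> carrier R" "v s1 r1 = p" using ex pq by blast
    obtain s2 r2 where 2: "s2 \<in> S" "r2 \<in> carrier R" "v s2 r2 = q" using ex pq by blast
    have "{t \<otimes>\<^bsub>R\<^esub> r1 | t. t \<in> S} \<inter> {a \<otimes>\<^bsub>R\<^esub> s2 | a. a \<in> carrier R} \<noteq> {}"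
      using ms 1 2 by blast
    then obtain t a where 3: "t \<in> S" "a \<in> carrier R" "t \<otimes>\<^bsub>R\<^esub> r1 = a \<otimes>\<^bsub>R\<^esub> s2" by auto
    have gen: "left_fraction R S (t \<otimes>\<^bsub>R\<^esub> s1) (a \<otimes>\<^bsub>R\<^esub> r2) = C (p \<otimes>\<^bsub>F\<^esub> q)"
      if "s1 \<in> S" "r1 \<in> carrier R" "v s1 r1 = p" "s2 \<in> S" "r2 \<in> carrier R" "v s2 r2 = q"
       "t \<in> S" "a \<in> carrier R" "t \<otimes>\<^bsub>R\<^esub> r1 = a \<otimes>\<^bsub>R\<^esub> s2" for s1 r1 s2 r2 t a
    proof -
      have e: "h r1 = h s1 \<otimes>\<^bsub>F\<^esub> p" "h r2 = h s2 \<otimes>\<^bsub>F\<^esub> q" using vq that pq by auto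
      have "h t \<otimes>\<^bsub>F\<^esub> h r1 = h a \<otimes>\<^bsub>F\<^esub> h s2" using that hm SR by metis
      then have "h (a \<otimes>\<^bsub>R\<^esub> r2) = h (t \<otimes>\<^bsub>R\<^esub> s1) \<otimes>\<^bsub>F\<^esub> (p \<otimes>\<^bsub>F\<^esub> q)"
        using that e SR hc pq by (simp add: hm) (metis F.m_assoc F.m_closed hc)
      then show ?thesis using that ms pq SR vq[of "t \<otimes>\<^bsub>R\<^esub> s1" "a \<otimes>\<^bsub>R\<^esub> r2" "p \<otimes>\<^bsub>F\<^esub> q"]
        by (subst lf) auto
    qed
    show ?thesis unfolding left_localization_def
      using 1 2 3 gen by (simp add: Cin) (rule eqU; blast)
  qed
  have add: "C p \<oplus>\<^bsub>left_localization R S\<^esub> C q = C (p \<oplus>\<^bsub>F\<^esub> q)" if pq: "p \<in> carrier F" "q \<in> carrier F" for p q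
  proof -
    obtain s1 r1 where 1: "s1 \<in> S" "r1 \<in> carrier R" "v s1 r1 = p" using ex pq by blast
    obtain s2 r2 where 2: "s2 \<in> S" "r2 \<in> carrier R" "v s2 r2 = q" using ex pq by blast
    have "{t \<otimes>\<^bsub>R\<^esub> s1 | t. t \<in> S} \<inter> {a \<otimes>\<^bsub>R\<^esub> s2 | a. a \<in> carrier R} \<noteq> {}"
      using ms 1 2 SR by blast
    then obtain t a where 3: "t \<in> S" "a \<in> carrier R" "t \<otimes>\<^bsub>R\<^esub> s1 = a \<otimes>\<^bsub>R\<^esub> s2" by auto
    have 4: "t \<in> carrier R" "t \<otimes>\<^bsub>R\<^esub> s1 \<in> S" using 3 1 ms SR by metis+
    have gen: "left_fraction R S (c \<otimes>\<^bsub>R\<^esub> s1) (c \<otimes>\<^bsub>R\<^esub> r1 \<oplus>\<^bsub>R\<^esub> d \<otimes>\<^bsub>R\<^esub> r2) = C (p \<oplus>\<^bsub>F\<^esub> q)"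
      if "s1 \<in> S" "r1 \<in> carrier R" "v s1 r1 = p" "s2 \<in> S" "r2 \<in> carrier R" "v s2 r2 = q"
       "c \<in> carrier R" "d \<in> carrier R" "c \<otimes>\<^bsub>R\<^esub> s1 = d \<otimes>\<^bsub>R\<^esub> s2" "c \<otimes>\<^bsub>R\<^esub> s1 \<in> S" for s1 r1 s2 r2 c d
    proof -
      have e: "h r1 = h s1 \<otimes>\<^bsub>F\<^esub> p" "h r2 = h s2 \<otimes>\<^bsub>F\<^esub> q" using vq that pq by auto
      have x: "h c \<otimes>\<^bsub>F\<^esub> h s1 = h d \<otimes>\<^bsub>F\<^esub> h s2" using that hm SR by metis
      have "h (c \<otimes>\<^bsub>R\<^esub> r1 \<oplus>\<^bsub>R\<^esub> d \<otimes>\<^bsub>R\<^esub> r2) = h (c \<otimes>\<^bsub>R\<^esub> s1) \<otimes>\<^bsub>F\<^esub> (p \<oplus>\<^bsub>F\<^esub> q)"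
        using that e x SR hc pq by (simp add: hm ha F.r_distr F.m_assoc[symmetric])
      then show ?thesis using that ms pq SR vq[of "c \<otimes>\<^bsub>R\<^esub> s1" "c \<otimes>\<^bsub>R\<^esub> r1 \<oplus>\<^bsub>R\<^esub> d \<otimes>\<^bsub>R\<^esub> r2" "p \<oplus>\<^bsub>F\<^esub> q"]
        by (subst lf) auto
    qed
    show ?thesis
      apply (simp only: left_localization_def ring.simps)
      apply (rule eqU)
      subgoal
        apply (simp only: Cin ex_in_conv[symmetric] mem_Collect_eq)
        apply (intro exI conjI)
        apply (rule refl)
        by (rule 1(1), rule 1(2), rule 1(3), rule 2(1), rule 2(2), rule 2(3), rule 4(1), rule 3(2), rule 3(3), rule 4(2))
      subgoal for x
        using gen by (auto simp: Cin)
      done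
  qed
  have sml: "k \<odot>\<^bsub>left_localization R S\<^esub> C q = C (k \<odot>\<^bsub>F\<^esub> q)" if q: "q \<in> carrier F" for k q
  proof -
    have gen: "left_fraction R S s (k \<odot>\<^bsub>R\<^esub> r) = C (k \<odot>\<^bsub>F\<^esub> q)" if "s \<in> S" "r \<in> carrier R" "v s r = q" for s r
    proof -
      have "h (k \<odot>\<^bsub>R\<^esub> r) = h s \<otimes>\<^bsub>F\<^esub> (k \<odot>\<^bsub>F\<^esub> q)"
        using that sm sm2[OF hc[OF SR[OF that(1)]] q] vq q by metis
      then show ?thesis using that sm sm3 q vq lf by metis
    qed
    show ?thesis unfolding left_localization_def
      using ex[OF q] gen by (simp add: Cin) (rule eqU; blast)
  qed
  have one: "\<one>\<^bsub>left_localization R S\<^esub> = C \<one>\<^bsub>F\<^esub>"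
    using lf[of "\<one>\<^bsub>R\<^esub>" "\<one>\<^bsub>R\<^esub>"] ms by (simp add: left_localization_def v_def h1)
  let ?g = "the_inv_into (carrier F) C"
  have g: "?g (C q) = q" if "q \<in> carrier F" for q using that injC by (simp add: the_inv_into_f_f)
  have "?g \<in> ring_iso (left_localization R S) F"
    unfolding ring_iso_def ring_hom_def car
    using injC by (auto simp: g mult add one bij_betw_the_inv_into inj_on_imp_bij_betw)
  moreover have "\<forall>k. \<forall>a\<in>carrier (left_localization R S). ?g (k \<odot>\<^bsub>left_localization R S\<^esub> a) = k \<odot>\<^bsub>F\<^esub> ?g a"
    by (auto simp: car sml g sm3)
  ultimately show ?thesis unfolding algebra_iso_def by blast
qed
end

theory Submission
  imports Defs "HOL-Library.Function_Algebras"
begin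

text \<open>
  The homomorphism \<open>SS \<rightarrow> K(y)\<close> with \<open>x\<^sub>i \<mapsto> y\<^sub>i\<^sup>-\<^sup>1\<close> has kernel \<open>aa\<close>, because every element of \<open>SS\<close>
  becomes a polynomial in the \<open>y\<^sub>i\<close> after left multiplication by a monomial \<open>y\<^sup>\<gamma>\<close>. Clearing
  denominators in this way turns the Ore condition into commutativity of \<open>YY\<close>, so every
  multiplicative set between \<open>YY \<setminus> {0}\<close> and \<open>SS \<setminus> aa\<close> is a left denominator set with associated
  ideal \<open>aa\<close> and localization \<open>K(y)\<close>. As \<open>SS\<close> is a free right \<open>YY\<close>-module on the \<open>x\<^sup>\<alpha>\<close>, nonzero
  elements of \<open>YY\<close> are left regular; a left regular element is not in \<open>aa\<close>, since it cannot be
  annihilated by \<open>y\<^sup>\<gamma>\<close>. Hence all left regular elements form such a set, which is therefore the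
  largest left regular denominator set, and its intersection with \<open>YY\<close> is \<open>YY \<setminus> {0}\<close>.
\<close>

section \<open>Linear extension from monomials\<close>

text \<open>The function \<open>f\<close> receives the coefficient along with the index, so one
  notion serves both for scalar coefficients and, in \<open>normal_form\<close>, for polynomial
  ones. Additivity in the coefficient is required only where it is used.\<close>

definition linear_ext :: "('a \<Rightarrow> 'b::zero \<Rightarrow> 'c::comm_monoid_add) \<Rightarrow> ('a \<Rightarrow>\<^sub>0 'b) \<Rightarrow> 'c" where
  "linear_ext f p = (\<Sum>a\<in>Poly_Mapping.keys p. f a (Poly_Mapping.lookup p a))"

lemma linear_ext_superset:
  assumes "\<And>a. f a 0 = 0" "finite A" "Poly_Mapping.keys p \<subseteq> A"
  shows "linear_ext f p = (\<Sum>a\<in>A. f a (Poly_Mapping.lookup p a))"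
  unfolding linear_ext_def using assms
  by (intro sum.mono_neutral_left) (auto simp: in_keys_iff)

lemma linear_ext_zero [simp]: "linear_ext f 0 = 0"
  by (simp add: linear_ext_def)

lemma linear_ext_add:
  fixes p q :: "'a \<Rightarrow>\<^sub>0 'b::monoid_add"
  assumes "\<And>a. f a 0 = 0" "\<And>a b c. f a (b + c) = f a b + f a c"
  shows "linear_ext f (p + q) = linear_ext f p + linear_ext f q"
proof -
  let ?A = "Poly_Mapping.keys p \<union> Poly_Mapping.keys q"
  have "Poly_Mapping.keys (p + q) \<subseteq> ?A" by (rule Poly_Mapping.keys_add)
  then show ?thesis
    by (simp add: linear_ext_superset[of f ?A, OF assms(1)] lookup_add assms(2) sum.distrib)
qed

lemma linear_ext_single:
  assumes "\<And>a. f a 0 = 0"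
  shows "linear_ext f (Poly_Mapping.single a b) = f a b"
  using assms by (simp add: linear_ext_superset[of f "{a}"])

lemma poly_mapping_additive_induct [case_names zero single add]:
  fixes p :: "'a \<Rightarrow>\<^sub>0 'b::comm_monoid_add"
  assumes "P 0" "\<And>a b. P (Poly_Mapping.single a b)" "\<And>p q. P p \<Longrightarrow> P q \<Longrightarrow> P (p + q)"
  shows "P p"
proof -
  have P: "P (\<Sum>a\<in>A. Poly_Mapping.single a (Poly_Mapping.lookup p a))" if "finite A" for A
    using that by induction (auto intro: assms)
  have "p = (\<Sum>a\<in>Poly_Mapping.keys p. Poly_Mapping.single a (Poly_Mapping.lookup p a))"
    by (rule poly_mapping_eqI) (simp add: lookup_sum lookup_single when_def in_keys_iff sum.delta)
  then show ?thesis
    using P[of "Poly_Mapping.keys p"] by simp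
qed

section \<open>Modules over the free algebra\<close>

lemma free_algebra_simps [simp]:
  fixes p q :: "'g free_monoid \<Rightarrow>\<^sub>0 'k::field"
  shows "p \<oplus>\<^bsub>free_algebra\<^esub> q = p + q" "p \<otimes>\<^bsub>free_algebra\<^esub> q = p * q"
    "\<zero>\<^bsub>free_algebra\<^esub> = (0 :: 'g free_monoid \<Rightarrow>\<^sub>0 'k)" "\<one>\<^bsub>free_algebra\<^esub> = (1 :: 'g free_monoid \<Rightarrow>\<^sub>0 'k)"
    "k \<odot>\<^bsub>free_algebra\<^esub> p = Poly_Mapping.single 0 k * p"
    "carrier free_algebra = (UNIV :: ('g free_monoid \<Rightarrow>\<^sub>0 'k) set)"
  by (simp_all add: free_algebra_def ring_of_type_algebra_def ring.defs module.defs)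

lemma free_algebra_a_inv [simp]:
  fixes p :: "'g free_monoid \<Rightarrow>\<^sub>0 'k::field"
  shows "\<ominus>\<^bsub>free_algebra\<^esub> p = - p"
proof -
  interpret ring "free_algebra :: ('k, 'g free_monoid \<Rightarrow>\<^sub>0 'k) module" by (rule ring_free_algebra)
  show ?thesis using minus_equality[of "- p" p] by simp
qed

text \<open>A module over the free algebra, not a free module: by the universal property, one linear
  endomorphism \<open>gact g\<close> per generator determines the whole action.\<close>

locale free_module =
  fixes scale :: "'k::field \<Rightarrow> 'v::ab_group_add \<Rightarrow> 'v" (infixr \<open>*s\<close> 75)
    and gact :: "'g \<Rightarrow> 'v \<Rightarrow> 'v"
  assumes scale_left_distrib: "(k + l) *s v = k *s v + l *s v"
    and scale_right_distrib: "k *s (v + w) = k *s v + k *s w"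
    and scale_scale [simp]: "k *s l *s v = (k * l) *s v"
    and scale_one [simp]: "1 *s v = v"
    and gact_add: "gact g (v + w) = gact g v + gact g w"
    and gact_scale: "gact g (k *s v) = k *s gact g v"
begin

lemma scale_zero_left [simp]: "0 *s v = 0"
  using scale_left_distrib[of 0 0 v] by simp

lemma scale_zero_right [simp]: "k *s 0 = 0"
  using scale_right_distrib[of k 0 0] by simp

definition act :: "('g free_monoid \<Rightarrow>\<^sub>0 'k) \<Rightarrow> 'v \<Rightarrow> 'v" where
  "act a v = linear_ext (\<lambda>w k. k *s foldr gact (letters w) v) a"

lemma foldr_gact_add: "foldr gact l (v + w) = foldr gact l v + foldr gact l w"
  by (induction l) (simp_all add: gact_add)

lemma foldr_gact_scale: "foldr gact l (k *s v) = k *s foldr gact l v"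
  by (induction l) (simp_all add: gact_scale)

lemma act_zero [simp]: "act 0 v = 0"
  by (simp add: act_def)

lemma act_add: "act (a + b) v = act a v + act b v"
  unfolding act_def by (rule linear_ext_add) (simp_all add: scale_left_distrib)

lemma act_single: "act (Poly_Mapping.single w k) v = k *s foldr gact (letters w) v"
  unfolding act_def by (rule linear_ext_single) simp

lemma act_add_right: "act a (v + w) = act a v + act a w"
  by (induction a rule: poly_mapping_additive_induct)
    (simp_all add: act_add act_single foldr_gact_add scale_right_distrib algebra_simps)

lemma act_zero_right [simp]: "act a 0 = 0"
  using act_add_right[of a 0 0] by simp

lemma act_uminus: "act (- a) v = - act a v"
  using act_add[of a "- a" v] by (simp add: add_eq_0_iff)

lemma act_diff: "act (a - b) v = act a v - act b v"
  using act_add[of a "- b" v] by (simp add: act_uminus)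

lemma act_one [simp]: "act 1 v = v"
  by (simp flip: single_one add: act_single zero_free_monoid_def)

lemma act_scalar: "act (Poly_Mapping.single 0 k) v = k *s v"
  by (simp add: act_single zero_free_monoid_def)

lemma act_free_gen: "act (free_gen g) v = gact g v"
  by (simp add: free_gen_def act_single)

lemma act_mult: "act (a * b) v = act a (act b v)"
proof (induction a rule: poly_mapping_additive_induct)
  case (single w k)
  show ?case
    by (induction b rule: poly_mapping_additive_induct)
      (simp_all add: mult_single act_single act_add act_add_right distrib_left
        plus_free_monoid_def foldr_gact_scale)
qed (simp_all add: act_add distrib_right)

lemma ideal_annihilator: "ideal {a. \<forall>v. act a v = 0} free_algebra"
proof (rule idealI)
  interpret ring "free_algebra :: ('k, 'g free_monoid \<Rightarrow>\<^sub>0 'k) module" by (rule ring_free_algebra)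
  show "subgroup {a. \<forall>v. act a v = 0} (add_monoid free_algebra)"
    by (rule add.subgroupI) (auto simp: act_add act_uminus intro: exI[of _ 0])
qed (auto simp: act_mult ring_free_algebra)

text \<open>The elements acting as zero form an ideal, so it suffices to test generators. This is
  how an action descends from the free algebra to \<open>SS\<close>.\<close>

lemma act_genideal:
  assumes "a \<in> Idl\<^bsub>free_algebra\<^esub> R" "\<And>r v. r \<in> R \<Longrightarrow> act r v = 0"
  shows "act a v = 0"
  using ring.genideal_minimal[OF ring_free_algebra ideal_annihilator, of R] assms by blast

end

section \<open>Exponent vectors\<close>

abbreviation unit_exp :: "'n \<Rightarrow> ('n \<Rightarrow>\<^sub>0 nat)" where
  "unit_exp i \<equiv> Poly_Mapping.single i (Suc 0)"

definition exponent_of :: "'n list \<Rightarrow> ('n \<Rightarrow>\<^sub>0 nat)" where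
  "exponent_of l = sum_list (map unit_exp l)"

lemma exponent_of_simps [simp]:
  "exponent_of [] = 0" "exponent_of (i # l) = unit_exp i + exponent_of l"
  "exponent_of (l @ l') = exponent_of l + exponent_of l'"
  by (simp_all add: exponent_of_def)

lemma count_mset_exponent_of: "count (mset l) i = Poly_Mapping.lookup (exponent_of l) i"
  by (induction l) (auto simp: lookup_add lookup_single when_def)

lemma ex_exponent_of: "\<exists>l. exponent_of l = \<beta>"
proof -
  have fin: "finite {i. 0 < Poly_Mapping.lookup \<beta> i}"
    using finite_lookup[of \<beta>] by simp
  obtain l where l: "mset l = Abs_multiset (Poly_Mapping.lookup \<beta>)"
    using ex_mset by blast
  have "exponent_of l = \<beta>"
    by (rule poly_mapping_eqI) (simp flip: count_mset_exponent_of add: l count_Abs_multiset[OF fin])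
  then show ?thesis ..
qed

definition letters_of :: "('n \<Rightarrow>\<^sub>0 nat) \<Rightarrow> 'n list" where
  "letters_of \<beta> = (SOME l. exponent_of l = \<beta>)"

lemma exponent_of_letters_of [simp]: "exponent_of (letters_of \<beta>) = \<beta>"
  unfolding letters_of_def using ex_exponent_of by (rule someI_ex)

text \<open>The target may be noncommutative, so the product runs over an arbitrarily chosen word
  with exponent \<beta>; for commuting values of \<open>f\<close> the choice is immaterial by
  \<open>prod_list_eq_monomial\<close>.\<close>

definition monomial :: "('n \<Rightarrow> 'r::monoid_mult) \<Rightarrow> ('n \<Rightarrow>\<^sub>0 nat) \<Rightarrow> 'r" where
  "monomial f \<beta> = prod_list (map f (letters_of \<beta>))"

context
  fixes f :: "'n \<Rightarrow> 'r::monoid_mult"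
  assumes commute: "\<And>i j. f i * f j = f j * f i"
begin

lemma prod_list_eq_monomial: "prod_list (map f l) = monomial f (exponent_of l)"
proof -
  \<comment> \<open>The reordering principle for multisets is about \<open>fold\<close>, which
    multiplies in reverse order; hence the reversals.\<close>
  have fold_eq: "fold (\<lambda>i a. f i * a) l a = prod_list (map f (rev l)) * a" for l a
    by (induction l arbitrary: a) (simp_all add: mult.assoc)
  have "mset (rev l) = mset (rev (letters_of (exponent_of l)))"
    by (rule multiset_eqI) (simp add: count_mset_exponent_of)
  then have "fold (\<lambda>i a. f i * a) (rev l) 1 = fold (\<lambda>i a. f i * a) (rev (letters_of (exponent_of l))) 1"
    by (intro fun_cong[OF fold_multiset_equiv]) (auto simp: fun_eq_iff commute simp flip: mult.assoc)
  then show ?thesis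
    by (simp add: fold_eq monomial_def)
qed

lemma monomial_add: "monomial f (\<beta> + \<gamma>) = monomial f \<beta> * monomial f \<gamma>"
  using prod_list_eq_monomial[of "letters_of \<beta> @ letters_of \<gamma>"] by (simp add: monomial_def)

lemma monomial_unit_exp [simp]: "monomial f (unit_exp i) = f i"
  using prod_list_eq_monomial[of "[i]"] by simp

lemma monomial_zero [simp]: "monomial f 0 = 1"
  using prod_list_eq_monomial[of "[]"] by simp

end

section \<open>Two modules over the algebra of one-sided inverses\<close>

type_synonym ('n, 'k) mpoly = "('n \<Rightarrow>\<^sub>0 nat) \<Rightarrow>\<^sub>0 'k"
type_synonym ('n, 'k) ratfun = "(('n \<Rightarrow>\<^sub>0 nat) \<Rightarrow>\<^sub>0 'k) fract"

definition of_mpoly :: "('n::linorder, 'k::field) mpoly \<Rightarrow> ('n, 'k) ratfun" where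
  "of_mpoly p = Fract p 1"

lemma of_mpoly_simps [simp]:
  "of_mpoly (p + q) = of_mpoly p + of_mpoly q" "of_mpoly (p * q) = of_mpoly p * of_mpoly q"
  "of_mpoly 0 = 0" "of_mpoly 1 = 1" "of_mpoly p = of_mpoly q \<longleftrightarrow> p = q"
  by (simp_all add: of_mpoly_def Zero_fract_def One_fract_def eq_fract)

lemma of_mpoly_eq_0_iff [simp]: "of_mpoly p = 0 \<longleftrightarrow> p = 0"
  using of_mpoly_simps(5)[of p 0] by (simp del: of_mpoly_simps(5))

definition var :: "'n::linorder \<Rightarrow> ('n, 'k::field) ratfun" where
  "var i = of_mpoly (Poly_Mapping.single (unit_exp i) 1)"

definition const :: "'k::field \<Rightarrow> ('n::linorder, 'k) ratfun" where
  "const k = of_mpoly (Poly_Mapping.single 0 k)"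

lemma var_nonzero [simp]: "var i \<noteq> 0"
  by (simp add: var_def) (metis lookup_single_eq lookup_zero one_neq_zero)

lemma const_simps [simp]:
  "const (k + l) = const k + const l" "const (k * l) = const k * const l" "const 1 = 1" "const 0 = 0"
  by (simp_all add: const_def single_add mult_single flip: of_mpoly_simps(1,2))

lemma of_mpoly_single:
  "of_mpoly (Poly_Mapping.single \<beta> k) = const k * monomial var \<beta>"
proof -
  have "Poly_Mapping.single (\<beta> + \<gamma>) 1 = Poly_Mapping.single \<beta> 1 * (Poly_Mapping.single \<gamma> 1 :: ('a, 'b) mpoly)" for \<beta> \<gamma>
    by (simp add: mult_single)
  then have "of_mpoly (Poly_Mapping.single (exponent_of l) 1) = (prod_list (map var l) :: ('a, 'b) ratfun)" for l
    by (induction l) (simp_all add: var_def)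
  from this[of "letters_of \<beta>"]
  have "of_mpoly (Poly_Mapping.single \<beta> 1) = (monomial var \<beta> :: ('a, 'b) ratfun)"
    by (simp add: monomial_def)
  moreover have "Poly_Mapping.single \<beta> k = Poly_Mapping.single 0 k * Poly_Mapping.single \<beta> 1"
    by (simp add: mult_single)
  ultimately show ?thesis
    by (simp add: const_def)
qed

section \<open>Two actions that respect the defining relations\<close>

lemma relator_cases:
  assumes "r \<in> relators"
  obtains (inverse) i where "r = free_gen (gen_y i) * free_gen (gen_x i) - 1"
  | (xy) i j where "i \<noteq> j" "r = free_gen (gen_x i) * free_gen (gen_y j) - free_gen (gen_y j) * free_gen (gen_x i)"
  | (xx) i j where "i \<noteq> j" "r = free_gen (gen_x i) * free_gen (gen_x j) - free_gen (gen_x j) * free_gen (gen_x i)"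
  | (yy) i j where "i \<noteq> j" "r = free_gen (gen_y i) * free_gen (gen_y j) - free_gen (gen_y j) * free_gen (gen_y i)"
  using assms unfolding relators_def by auto

text \<open>Here \<open>x_i\<close> acts as the inverse of \<open>y_i\<close>. Both kinds of
  generators act by multiplication in a field, so this module sees only a commutative quotient of
  \<open>SS\<close>; it is the source of \<open>to_rat\<close>.\<close>

primrec rat_gact :: "'n::linorder gen \<Rightarrow> ('n, 'k::field) ratfun \<Rightarrow> ('n, 'k) ratfun" where
  "rat_gact (gen_x i) q = q / var i"
| "rat_gact (gen_y i) q = var i * q"

interpretation rat: free_module "\<lambda>k q. const k * q" rat_gact
proof
  fix g :: "'n::linorder gen" and v w :: "('n, 'k::field) ratfun" and k
  show "rat_gact g (v + w) = rat_gact g v + rat_gact g w"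
    by (cases g) (simp_all add: add_divide_distrib distrib_left)
  show "rat_gact g (const k * v) = const k * rat_gact g v"
    by (cases g) simp_all
qed (simp_all add: algebra_simps)

lemma rat_act_relators: "r \<in> relators \<Longrightarrow> rat.act r q = 0"
  by (erule relator_cases) (simp_all add: rat.act_diff rat.act_mult rat.act_free_gen)

text \<open>
  The left multiplication of \<open>SS\<close> on itself, in coordinates with respect to the basis \<open>x\<^sup>\<alpha>\<close> of the
  right \<open>YY\<close>-module \<open>SS\<close>, with coefficients extended to the field of fractions of \<open>YY\<close>.
\<close>

primrec reg_gact :: "'n::linorder gen \<Rightarrow> (('n \<Rightarrow>\<^sub>0 nat) \<Rightarrow> ('n, 'k::field) ratfun)
    \<Rightarrow> ('n \<Rightarrow>\<^sub>0 nat) \<Rightarrow> ('n, 'k) ratfun" where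
  "reg_gact (gen_x i) f = (\<lambda>\<alpha>. if Poly_Mapping.lookup \<alpha> i = 0 then 0 else f (\<alpha> - unit_exp i))"
| "reg_gact (gen_y i) f =
    (\<lambda>\<alpha>. f (\<alpha> + unit_exp i) + (if Poly_Mapping.lookup \<alpha> i = 0 then var i * f \<alpha> else 0))"

interpretation reg: free_module "\<lambda>k f \<alpha>. const k * f \<alpha>" reg_gact
proof
  fix g :: "'n::linorder gen" and v w :: "('n \<Rightarrow>\<^sub>0 nat) \<Rightarrow> ('n, 'k::field) ratfun" and k
  show "reg_gact g (v + w) = reg_gact g v + reg_gact g w"
    by (cases g) (auto simp: fun_eq_iff algebra_simps)
  show "reg_gact g (\<lambda>\<alpha>. const k * v \<alpha>) = (\<lambda>\<alpha>. const k * reg_gact g v \<alpha>)"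
    by (cases g) (auto simp: fun_eq_iff algebra_simps)
qed (auto simp: fun_eq_iff algebra_simps)

lemma exp_diff_add:
  fixes \<alpha> :: "'n \<Rightarrow>\<^sub>0 nat"
  assumes "Poly_Mapping.lookup \<alpha> i \<noteq> 0"
  shows "\<alpha> - unit_exp i + \<beta> = \<alpha> + \<beta> - unit_exp i"
  by (rule poly_mapping_eqI) (use assms in \<open>auto simp: lookup_add lookup_minus lookup_single when_def\<close>)

lemma exp_diff_commute: "\<alpha> - \<beta> - \<gamma> = \<alpha> - \<gamma> - (\<beta> :: 'n \<Rightarrow>\<^sub>0 nat)"
  by (rule poly_mapping_eqI) (simp add: lookup_minus)

text \<open>The action encodes that \<open>y_i\<close> times the monomial with exponent \<alpha>
  lowers the exponent of \<open>x_i\<close> if that is positive, and otherwise passes to the right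
  as a coefficient. The relations hold coordinatewise: an operator with index j leaves the entry of
  \<alpha> at i unchanged for i \<noteq> j, so shifts and case tests commute.\<close>

lemma reg_act_relators:
  assumes "r \<in> relators"
  shows "reg.act r f = 0"
  using assms
proof (cases rule: relator_cases)
  case (inverse i)
  then show ?thesis
    by (simp add: reg.act_diff reg.act_mult reg.act_free_gen fun_eq_iff lookup_add)
next
  case (xy i j)
  then show ?thesis
    by (auto simp add: reg.act_diff reg.act_mult reg.act_free_gen fun_eq_iff lookup_add lookup_minus
      lookup_single exp_diff_add when_def)
next
  case (xx i j)
  then show ?thesis
    by (auto simp add: reg.act_diff reg.act_mult reg.act_free_gen fun_eq_iff lookup_add lookup_minus
      lookup_single exp_diff_commute[of _ "unit_exp i" "unit_exp j"] when_def)
next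
  case (yy i j)
  have "\<alpha> + unit_exp i + unit_exp j = \<alpha> + unit_exp j + unit_exp i" for \<alpha>
    by (simp only: ac_simps)
  then have "reg_gact (gen_y i) (reg_gact (gen_y j) f) = reg_gact (gen_y j) (reg_gact (gen_y i) f)"
    using yy(1) by (simp add: fun_eq_iff lookup_add lookup_single when_def distrib_left)
  then show ?thesis
    unfolding yy(2) by (simp only: reg.act_diff reg.act_mult reg.act_free_gen) simp
qed

section \<open>The algebra of one-sided inverses as a type\<close>

definition osi_rel :: "('n gen free_monoid \<Rightarrow>\<^sub>0 'k::field) \<Rightarrow> _ \<Rightarrow> bool" where
  "osi_rel a b \<longleftrightarrow> a - b \<in> Idl\<^bsub>free_algebra\<^esub> relators"

lemma relator_ideal_closed:
  fixes a b c :: "'n gen free_monoid \<Rightarrow>\<^sub>0 'k::field"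
  defines "I \<equiv> Idl\<^bsub>free_algebra\<^esub> relators"
  shows "0 \<in> I" "a \<in> I \<Longrightarrow> b \<in> I \<Longrightarrow> a + b \<in> I" "a \<in> I \<Longrightarrow> - a \<in> I"
    "a \<in> I \<Longrightarrow> c * a \<in> I" "a \<in> I \<Longrightarrow> a * c \<in> I"
proof -
  interpret I: ideal I "free_algebra :: ('k, 'n gen free_monoid \<Rightarrow>\<^sub>0 'k) module"
    unfolding I_def by (rule ideal_relators)
  show "0 \<in> I"
    using additive_subgroup.zero_closed[OF I.is_additive_subgroup] unfolding free_algebra_simps .
  show "a + b \<in> I" if "a \<in> I" "b \<in> I"
    using additive_subgroup.a_closed[OF I.is_additive_subgroup that] unfolding free_algebra_simps .
  show "- a \<in> I" if "a \<in> I"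
    using additive_subgroup.a_inv_closed[OF I.is_additive_subgroup that] unfolding free_algebra_a_inv .
  show "c * a \<in> I" "a * c \<in> I" if "a \<in> I"
    using I.I_l_closed[OF that, of c] I.I_r_closed[OF that, of c] unfolding free_algebra_simps by simp_all
qed

lemma osi_rel_sum:
  "osi_rel a b \<Longrightarrow> osi_rel c d \<Longrightarrow> osi_rel (a + c) (b + d)"
  "osi_rel a b \<Longrightarrow> osi_rel (- a) (- b)"
  using relator_ideal_closed(2)[of "a - b" "c - d"] relator_ideal_closed(3)[of "a - b"]
  by (simp_all add: osi_rel_def algebra_simps)

lemma osi_rel_mult:
  assumes "osi_rel a b" "osi_rel c d"
  shows "osi_rel (a * c) (b * d)"
proof -
  have "a * c - b * d = (a - b) * c + b * (c - d)"
    by (simp add: algebra_simps)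
  then show ?thesis
    using assms relator_ideal_closed(2,4,5) unfolding osi_rel_def by metis
qed

lemma osi_rel_refl [simp]: "osi_rel a a"
  by (simp add: osi_rel_def relator_ideal_closed(1))

\<comment> \<open>A copy of \<open>SS\<close> as a type, so that computations can use the type class
  \<open>ring_1\<close> instead of a carrier; \<open>coset\<close> carries the results back.\<close>
quotient_type (overloaded) ('n, 'k) osi = "'n gen free_monoid \<Rightarrow>\<^sub>0 'k::field" / osi_rel
proof (rule equivpI)
  show "symp (osi_rel :: ('n gen free_monoid \<Rightarrow>\<^sub>0 'k) \<Rightarrow> _)"
  proof (rule sympI)
    show "osi_rel b a" if "osi_rel a b" for a b :: "'n gen free_monoid \<Rightarrow>\<^sub>0 'k"
      using relator_ideal_closed(3)[of "a - b"] that by (simp add: osi_rel_def)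
  qed
  show "transp (osi_rel :: ('n gen free_monoid \<Rightarrow>\<^sub>0 'k) \<Rightarrow> _)"
  proof (rule transpI)
    show "osi_rel a c" if "osi_rel a b" "osi_rel b c" for a b c :: "'n gen free_monoid \<Rightarrow>\<^sub>0 'k"
      using relator_ideal_closed(2)[of "a - b" "b - c"] that by (simp add: osi_rel_def)
  qed
qed (simp add: reflp_def)

lemma rat_act_osi_rel: "osi_rel a b \<Longrightarrow> rat.act a q = rat.act b q"
  using rat.act_genideal[of "a - b" relators q, OF _ rat_act_relators]
  by (simp add: osi_rel_def rat.act_diff)

lemma reg_act_osi_rel: "osi_rel a b \<Longrightarrow> reg.act a f = reg.act b f"
  using reg.act_genideal[of "a - b" relators f, OF _ reg_act_relators]
  by (simp add: osi_rel_def reg.act_diff)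

instantiation osi :: (linorder, field) ring_1
begin

lift_definition zero_osi :: "('a, 'b) osi" is 0 .
lift_definition one_osi :: "('a, 'b) osi" is 1 .
lift_definition plus_osi :: "('a, 'b) osi \<Rightarrow> ('a, 'b) osi \<Rightarrow> ('a, 'b) osi" is "(+)"
  by (rule osi_rel_sum)
lift_definition uminus_osi :: "('a, 'b) osi \<Rightarrow> ('a, 'b) osi" is uminus
  by (rule osi_rel_sum)
lift_definition times_osi :: "('a, 'b) osi \<Rightarrow> ('a, 'b) osi \<Rightarrow> ('a, 'b) osi" is "(*)"
  by (rule osi_rel_mult)

definition minus_osi :: "('a, 'b) osi \<Rightarrow> ('a, 'b) osi \<Rightarrow> ('a, 'b) osi" where
  "minus_osi a b = a + - b"

instance
proof
  fix a b c :: "('a, 'b) osi"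
  show "a + b + c = a + (b + c)" by transfer (simp add: add.assoc)
  show "a + b = b + a" by transfer (simp add: add.commute)
  show "0 + a = a" by transfer simp
  show "- a + a = 0" by transfer simp
  show "a - b = a + - b" by (rule minus_osi_def)
  show "a * b * c = a * (b * c)" by transfer (simp add: mult.assoc)
  show "1 * a = a" "a * 1 = a" by (transfer; simp)+
  show "(a + b) * c = a * c + b * c" by transfer (simp add: distrib_right)
  show "a * (b + c) = a * b + a * c" by transfer (simp add: distrib_left)
  show "(0 :: ('a, 'b) osi) \<noteq> 1"
  proof transfer
    show "\<not> osi_rel 0 (1 :: 'a gen free_monoid \<Rightarrow>\<^sub>0 'b)"
      \<comment> \<open>Nontriviality is witnessed on K(y), where 1 acts as the identity and 0 as
        zero.\<close>
      using rat_act_osi_rel[of "0 :: 'a gen free_monoid \<Rightarrow>\<^sub>0 'b" 1 1] by auto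
  qed
qed

end

section \<open>Generators, scalars and induction over elements\<close>

lift_definition gen_osi :: "'n::linorder gen \<Rightarrow> ('n, 'k::field) osi" is free_gen .
lift_definition scalar :: "'k::field \<Rightarrow> ('n::linorder, 'k) osi" is "Poly_Mapping.single 0" .

lift_definition rat_act :: "('n::linorder, 'k::field) osi \<Rightarrow> ('n, 'k) ratfun \<Rightarrow> ('n, 'k) ratfun"
  is rat.act by (rule ext, rule rat_act_osi_rel)

lift_definition reg_act :: "('n::linorder, 'k::field) osi \<Rightarrow> (('n \<Rightarrow>\<^sub>0 nat) \<Rightarrow> ('n, 'k) ratfun)
    \<Rightarrow> ('n \<Rightarrow>\<^sub>0 nat) \<Rightarrow> ('n, 'k) ratfun"
  is reg.act by (rule ext, rule reg_act_osi_rel)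

abbreviation "gx i \<equiv> gen_osi (gen_x i)"
abbreviation "gy i \<equiv> gen_osi (gen_y i)"

lemma osi_rel_relator:
  "a - b \<in> relators \<Longrightarrow> osi_rel a b"
  by (simp add: osi_rel_def relator_in)

lemma gy_gx [simp]: "gy i * gx i = 1"
  by transfer (rule osi_rel_relator, auto simp: relators_def)

lemma gx_gx: "gx i * gx j = gx j * gx i"
  by (cases "i = j") (simp, transfer, rule osi_rel_relator, auto simp: relators_def)

lemma gy_gy: "gy i * gy j = gy j * gy i"
  by (cases "i = j") (simp, transfer, rule osi_rel_relator, auto simp: relators_def)

lemma gx_gy: "i \<noteq> j \<Longrightarrow> gx i * gy j = gy j * gx i"
  by transfer (rule osi_rel_relator, auto simp: relators_def)

lemma scalar_simps [simp]:
  "scalar 0 = 0" "scalar 1 = 1" "scalar (k + l) = scalar k + scalar l"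
  "scalar (k * l) = scalar k * scalar l"
  by (transfer; simp add: single_add mult_single)+

lemma single_central: "Poly_Mapping.single 0 k * a = a * Poly_Mapping.single 0 k"
  for a :: "'a::monoid_add \<Rightarrow>\<^sub>0 'k::field"
  by (induction a rule: poly_mapping_additive_induct)
    (simp_all add: mult_single distrib_left distrib_right mult.commute)

lemma scalar_commute: "a * scalar k = scalar k * a"
  by transfer (simp add: single_central)

lemma abs_osi_word:
  fixes l :: "'n::linorder gen list" and k :: "'k::field"
  shows "abs_osi (Poly_Mapping.single (Word l) k) = scalar k * prod_list (map gen_osi l)"
proof (induction l arbitrary: k)
  case Nil
  then show ?case by (simp add: scalar.abs_eq zero_free_monoid_def)
next
  case (Cons g l)
  have "abs_osi (Poly_Mapping.single (Word (g # l)) k)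
      = gen_osi g * abs_osi (Poly_Mapping.single (Word l) k)"
    by (simp add: gen_osi.abs_eq times_osi.abs_eq free_gen_def mult_single plus_free_monoid_def)
  then show ?case
    by (simp add: Cons scalar_commute flip: mult.assoc)
qed

text \<open>Elements are sums of scalar multiples of words, and words grow by left multiplication
  with a generator, which matches the left actions.\<close>

lemma osi_induct [case_names zero one add scalar gen]:
  fixes P :: "('n::linorder, 'k::field) osi \<Rightarrow> bool"
  assumes "P 0" "P 1" "\<And>a b. P a \<Longrightarrow> P b \<Longrightarrow> P (a + b)" "\<And>k a. P a \<Longrightarrow> P (scalar k * a)"
    "\<And>g a. P a \<Longrightarrow> P (gen_osi g * a)"
  shows "P a"
proof -
  obtain p where a: "a = abs_osi p"
    using osi.abs_induct[of "\<lambda>a. \<exists>p. a = abs_osi p"] by blast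
  have prod: "P (prod_list (map gen_osi l))" for l
    by (induction l) (auto intro: assms)
  show ?thesis
    unfolding a
  proof (induction p rule: poly_mapping_additive_induct)
    case zero
    then show ?case using assms(1) by (simp add: zero_osi.abs_eq)
  next
    case (single w k)
    then show ?case using assms(4)[OF prod] by (cases w) (simp add: abs_osi_word)
  next
    case (add p q)
    then show ?case using assms(3) by (simp flip: plus_osi.abs_eq)
  qed
qed

lemma rat_act_simps [simp]:
  "rat_act 0 q = 0" "rat_act 1 q = q" "rat_act (a + b) q = rat_act a q + rat_act b q"
  "rat_act (a * b) q = rat_act a (rat_act b q)" "rat_act (scalar k) q = const k * q"
  "rat_act (gen_osi g) q = rat_gact g q"
  by (transfer; simp add: rat.act_add rat.act_mult rat.act_scalar rat.act_free_gen)+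

lemma reg_act_simps [simp]:
  "reg_act 0 f = 0" "reg_act 1 f = f" "reg_act (a + b) f = reg_act a f + reg_act b f"
  "reg_act (a * b) f = reg_act a (reg_act b f)" "reg_act (scalar k) f = (\<lambda>\<alpha>. const k * f \<alpha>)"
  "reg_act (gen_osi g) f = reg_gact g f"
  by (transfer; simp add: reg.act_add reg.act_mult reg.act_scalar reg.act_free_gen)+

section \<open>Rational functions as a quotient, and coordinates\<close>

text \<open>Generators act by multiplication operators, which commute with all others. Hence an
  element acts as multiplication by its value at 1, and \<open>to_rat\<close> is a ring
  homomorphism.\<close>

lemma rat_act_mult_right: "rat_act a (q * r) = rat_act a q * r"
proof (induction a arbitrary: q rule: osi_induct)
  case (gen g a)
  then show ?case by (cases g) simp_all
qed (simp_all add: distrib_right)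

definition to_rat :: "('n::linorder, 'k::field) osi \<Rightarrow> ('n, 'k) ratfun" where
  "to_rat a = rat_act a 1"

lemma rat_act_eq: "rat_act a q = to_rat a * q"
  using rat_act_mult_right[of a 1 q] by (simp add: to_rat_def)

lemma to_rat_simps [simp]:
  "to_rat 0 = 0" "to_rat 1 = 1" "to_rat (a + b) = to_rat a + to_rat b"
  "to_rat (a * b) = to_rat a * to_rat b" "to_rat (scalar k) = const k"
  "to_rat (gx i) = inverse (var i)" "to_rat (gy i) = var i"
  using rat_act_eq[of a "rat_act b 1"] by (simp_all add: to_rat_def inverse_eq_divide)

lemma to_rat_uminus [simp]: "to_rat (- a) = - to_rat a"
  using to_rat_simps(3)[of a "- a"] by (simp del: to_rat_simps(3) add: eq_neg_iff_add_eq_0 add.commute)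

lemma to_rat_diff [simp]: "to_rat (a - b) = to_rat a - to_rat b"
  using to_rat_simps(3)[of a "- b"] by simp

text \<open>Left multiplication is linear over the right coefficients, here extended to K(y). This
  allows division by a polynomial coefficient in \<open>ypoly_left_regular\<close>.\<close>

lemma reg_act_scale: "reg_act a (\<lambda>\<alpha>. q * f \<alpha>) = (\<lambda>\<alpha>. q * reg_act a f \<alpha>)"
proof (induction a arbitrary: f rule: osi_induct)
  case (gen g a)
  then show ?case by (cases g) (simp_all add: fun_eq_iff distrib_left)
qed (simp_all add: fun_eq_iff distrib_left)

text \<open>The coordinates of the monomial in the \<open>x_i\<close> with exponent \<beta>, times
  \<open>q\<close> on the right; \<open>delta 0 1\<close> represents the element 1.\<close>

definition delta :: "('n \<Rightarrow>\<^sub>0 nat) \<Rightarrow> ('n::linorder, 'k::field) ratfun \<Rightarrow> ('n \<Rightarrow>\<^sub>0 nat) \<Rightarrow> ('n, 'k) ratfun" where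
  "delta \<beta> q = (\<lambda>\<alpha>. if \<alpha> = \<beta> then q else 0)"

lemma delta_simps [simp]: "delta \<beta> q + delta \<beta> r = delta \<beta> (q + r)" "delta \<beta> 0 = 0"
  by (simp_all add: delta_def fun_eq_iff)

lemma unit_exp_neq_0: "\<alpha> + unit_exp i \<noteq> 0"
  by (metis lookup_add lookup_single_eq lookup_zero add_is_0 nat.distinct(1))

lemma gx_delta: "reg_act (gx i) (delta \<beta> q) = delta (unit_exp i + \<beta>) q"
proof -
  have "Poly_Mapping.lookup \<alpha> i \<noteq> 0 \<and> \<alpha> - unit_exp i = \<beta> \<longleftrightarrow> \<alpha> = unit_exp i + \<beta>" for \<alpha>
  proof
    assume a: "Poly_Mapping.lookup \<alpha> i \<noteq> 0 \<and> \<alpha> - unit_exp i = \<beta>"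
    show "\<alpha> = unit_exp i + \<beta>"
      by (rule poly_mapping_eqI)
        (use a in \<open>auto simp: lookup_add lookup_minus lookup_single when_def\<close>)
  qed (auto simp: lookup_add)
  note eq = this[symmetric]
  show ?thesis
    by (simp add: delta_def fun_eq_iff eq)
qed

lemma gy_delta: "reg_act (gy i) (delta 0 q) = delta 0 (var i * q)"
  by (auto simp: delta_def fun_eq_iff unit_exp_neq_0)

lemma monomial_gx_delta: "reg_act (monomial gx \<alpha>) (delta 0 q) = delta \<alpha> q"
proof -
  have "reg_act (prod_list (map gx l)) (delta 0 q) = delta (exponent_of l) q" for l
    by (induction l) (simp_all add: gx_delta del: reg_act_simps(6))
  from this[of "letters_of \<alpha>"] show ?thesis
    by (simp add: monomial_def)
qed

lemma monomial_gy_delta: "reg_act (monomial gy \<beta>) (delta 0 q) = delta 0 (monomial var \<beta> * q)"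
proof -
  have "reg_act (prod_list (map gy l)) (delta 0 q) = delta 0 (prod_list (map var l) * q)" for l
    by (induction l) (simp_all add: gy_delta mult.assoc del: reg_act_simps(6))
  from this[of "letters_of \<beta>"] show ?thesis
    by (simp add: monomial_def)
qed

section \<open>The polynomial subalgebra\<close>

lemma scalar_left_commute: "a * (scalar k * b) = scalar k * (a * b)"
  by (metis mult.assoc scalar_commute)


text \<open>Evaluation of polynomials at the \<open>y_i\<close>. Parametrizing \<open>YY\<close> by
  a polynomial ring provides commutativity and the absence of zero divisors from the type
  class.\<close>

definition ypoly :: "('n::linorder, 'k::field) mpoly \<Rightarrow> ('n, 'k) osi" where
  "ypoly = linear_ext (\<lambda>\<beta> k. scalar k * monomial gy \<beta>)"

lemma ypoly_zero [simp]: "ypoly 0 = 0"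
  by (simp add: ypoly_def)

lemma ypoly_add: "ypoly (p + q) = ypoly p + ypoly q"
  unfolding ypoly_def by (rule linear_ext_add) (simp_all add: distrib_right)

lemma ypoly_single: "ypoly (Poly_Mapping.single \<beta> k) = scalar k * monomial gy \<beta>"
  unfolding ypoly_def by (rule linear_ext_single) simp

lemma ypoly_mult: "ypoly (p * q) = ypoly p * ypoly q"
proof (induction p rule: poly_mapping_additive_induct)
  case (single \<beta> k)
  show ?case
  proof (induction q rule: poly_mapping_additive_induct)
    case (single \<gamma> l)
    show ?case
      by (simp add: mult_single ypoly_single monomial_add[of gy, OF gy_gy] mult.assoc
        scalar_left_commute[of "monomial gy \<beta>"])
  qed (simp_all add: ypoly_add distrib_left)
qed (simp_all add: ypoly_add distrib_right)

lemma ypoly_uminus: "ypoly (- p) = - ypoly p"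
  using ypoly_add[of p "- p"] by (simp add: eq_neg_iff_add_eq_0 add.commute)

lemma ypoly_one [simp]: "ypoly 1 = 1"
  by (simp flip: single_one add: ypoly_single monomial_zero[of gy, OF gy_gy])

lemma ypoly_commute: "ypoly p * ypoly q = ypoly q * ypoly p"
  by (simp flip: ypoly_mult add: mult.commute)

lemma ypoly_scalar: "ypoly (Poly_Mapping.single 0 k) = scalar k"
  by (simp add: ypoly_single monomial_zero[of gy, OF gy_gy])

lemma ypoly_monomial: "ypoly (Poly_Mapping.single \<beta> 1) = monomial gy \<beta>"
  by (simp add: ypoly_single)

lemma ypoly_gy: "ypoly (Poly_Mapping.single (unit_exp i) 1) = gy i"
  by (simp add: ypoly_monomial monomial_unit_exp[of gy, OF gy_gy])

lemma reg_act_ypoly: "reg_act (ypoly p) (delta 0 q) = delta 0 (of_mpoly p * q)"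
proof (induction p rule: poly_mapping_additive_induct)
  case (single \<beta> k)
  show ?case
    by (simp add: ypoly_single of_mpoly_single monomial_gy_delta) (simp add: delta_def fun_eq_iff)
qed (simp_all add: ypoly_add distrib_right)

lemma to_rat_prod_gy: "to_rat (prod_list (map gy l)) = prod_list (map var l)"
  by (induction l) simp_all

lemma to_rat_ypoly [simp]: "to_rat (ypoly p) = of_mpoly p"
proof (induction p rule: poly_mapping_additive_induct)
  case (single \<beta> k)
  show ?case
    by (simp add: ypoly_single of_mpoly_single monomial_def to_rat_prod_gy)
qed (simp_all add: ypoly_add)

text \<open>Algebraic independence of the \<open>y_i\<close> in \<open>SS\<close>: it can be read
  off in K(y), where \<open>to_rat\<close> recovers the polynomial.\<close>

lemma inj_ypoly: "ypoly p = ypoly q \<longleftrightarrow> p = q"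
  by (metis to_rat_ypoly of_mpoly_simps(5))

lemma ypoly_eq_0_iff [simp]: "ypoly p = 0 \<longleftrightarrow> p = 0"
  using inj_ypoly[of p 0] by simp

text \<open>A leading \<open>x_i\<close> is cancelled by one more factor \<open>y_i\<close> on the
  left, a leading \<open>y_i\<close> moves past the monomial and joins the polynomial, and a sum is
  cleared by the product of the two monomials.\<close>

lemma clear_denominator:
  fixes a :: "('n::linorder, 'k::field) osi"
  shows "\<exists>\<gamma> p. monomial gy \<gamma> * a = ypoly p"
proof (induction a rule: osi_induct)
  case zero
  show ?case by (auto intro: exI[of _ 0])
next
  case one
  show ?case by (metis mult_1_right ypoly_monomial)
next
  case (add a b)
  then obtain \<beta> p \<gamma> q where "monomial gy \<beta> * a = ypoly p" "monomial gy \<gamma> * b = ypoly q"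
    by blast
  moreover have "monomial gy (\<beta> + \<gamma>) * (a + b)
      = ypoly (Poly_Mapping.single \<gamma> 1) * (monomial gy \<beta> * a)
        + ypoly (Poly_Mapping.single \<beta> 1) * (monomial gy \<gamma> * b)"
    unfolding ypoly_monomial distrib_left mult.assoc[symmetric] monomial_add[of gy, OF gy_gy, symmetric]
    by (simp only: add.commute)
  ultimately have "monomial gy (\<beta> + \<gamma>) * (a + b)
      = ypoly (Poly_Mapping.single \<gamma> 1 * p + Poly_Mapping.single \<beta> 1 * q)"
    by (simp only: ypoly_add ypoly_mult)
  then show ?case by blast
next
  case (scalar k a)
  then obtain \<beta> p where "monomial gy \<beta> * a = ypoly p"
    by blast
  then have "monomial gy \<beta> * (scalar k * a) = ypoly (Poly_Mapping.single 0 k * p)"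
    by (simp add: ypoly_mult ypoly_scalar scalar_left_commute[of "monomial gy \<beta>"])
  then show ?case by blast
next
  case (gen g a)
  then obtain \<beta> p where a: "monomial gy \<beta> * a = ypoly p"
    by blast
  show ?case
  proof (cases g)
    case (gen_x i)
    have "monomial gy (\<beta> + unit_exp i) * (gx i * a) = monomial gy \<beta> * (gy i * gx i) * a"
      by (simp only: monomial_add[of gy, OF gy_gy] monomial_unit_exp[of gy, OF gy_gy] mult.assoc)
    then have "monomial gy (\<beta> + unit_exp i) * (gx i * a) = ypoly p"
      by (simp only: gy_gx mult_1_right a)
    then show ?thesis unfolding gen_x by blast
  next
    case (gen_y i)
    have "monomial gy \<beta> * (gy i :: ('n, 'k) osi) = gy i * monomial gy \<beta>"
      using ypoly_commute[of "Poly_Mapping.single \<beta> 1" "Poly_Mapping.single (unit_exp i) 1"]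
      by (simp only: ypoly_monomial monomial_unit_exp[of gy, OF gy_gy])
    then have "monomial gy \<beta> * (gy i * a) = ypoly (Poly_Mapping.single (unit_exp i) 1 * p)"
      by (simp only: ypoly_mult ypoly_gy flip: mult.assoc a)
    then show ?thesis unfolding gen_y by blast
  qed
qed

section \<open>Left regularity of polynomials\<close>

text \<open>The basis expansion grouped by the power of the \<open>x_i\<close>, with polynomials in
  the \<open>y_i\<close> as right coefficients.\<close>

definition normal_form :: "(('n::linorder \<Rightarrow>\<^sub>0 nat) \<Rightarrow>\<^sub>0 ('n, 'k::field) mpoly) \<Rightarrow> ('n, 'k) osi" where
  "normal_form = linear_ext (\<lambda>\<alpha> p. monomial gx \<alpha> * ypoly p)"

lemma normal_form_zero [simp]: "normal_form 0 = 0"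
  by (simp add: normal_form_def)

lemma normal_form_add: "normal_form (g + h) = normal_form g + normal_form h"
  unfolding normal_form_def by (rule linear_ext_add) (simp_all add: ypoly_add distrib_left)

lemma normal_form_single: "normal_form (Poly_Mapping.single \<alpha> p) = monomial gx \<alpha> * ypoly p"
  unfolding normal_form_def by (rule linear_ext_single) simp

lemma gy_prod_gx:
  fixes l :: "'n::linorder list"
  assumes "i \<notin> set l"
  shows "gy i * prod_list (map gx l) = (prod_list (map gx l) * gy i :: ('n, 'k::field) osi)"
  using assms
proof (induction l)
  case (Cons j l)
  then have "i \<noteq> j" by simp
  then have "gy i * (gx j * c) = gx j * (gy i * c)" for c :: "('n, 'k) osi"
    by (simp only: gx_gy[of j i] flip: mult.assoc)
  then show ?case
    using Cons by (simp add: mult.assoc)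
qed simp

text \<open>Only \<open>y_i\<close> needs thought: if \<open>x_i\<close> occurs in the monomial, one
  factor cancels; otherwise \<open>y_i\<close> commutes with the monomial and is absorbed into the
  coefficient.\<close>

lemma gen_osi_normal_form_single:
  fixes p :: "('n::linorder, 'k::field) mpoly"
  shows "\<exists>h. gen_osi g * normal_form (Poly_Mapping.single \<alpha> p) = normal_form h"
proof (cases g)
  case (gen_x i)
  have "gx i * normal_form (Poly_Mapping.single \<alpha> p)
      = normal_form (Poly_Mapping.single (unit_exp i + \<alpha>) p)"
    by (simp add: normal_form_single monomial_add[of gx, OF gx_gx] monomial_unit_exp[of gx, OF gx_gx] mult.assoc)
  then show ?thesis unfolding gen_x by blast
next
  case (gen_y i)
  show ?thesis
  proof (cases "Poly_Mapping.lookup \<alpha> i = 0")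
    case True
    have "i \<notin> set (letters_of \<alpha>)"
      using True count_mset_exponent_of[of "letters_of \<alpha>" i] by (simp flip: count_mset_0_iff)
    then have "gy i * monomial gx \<alpha> = (monomial gx \<alpha> * gy i :: ('n, 'k) osi)"
      by (simp add: monomial_def gy_prod_gx)
    then have "gy i * normal_form (Poly_Mapping.single \<alpha> p)
        = normal_form (Poly_Mapping.single \<alpha> (Poly_Mapping.single (unit_exp i) 1 * p))"
      unfolding normal_form_single ypoly_mult ypoly_gy by (simp flip: mult.assoc)
    then show ?thesis unfolding gen_y by blast
  next
    case False
    have "\<alpha> = unit_exp i + (\<alpha> - unit_exp i)"
      by (rule poly_mapping_eqI) (use False in \<open>auto simp: lookup_add lookup_minus lookup_single when_def\<close>)
    then have "monomial gx \<alpha> = (gx i * monomial gx (\<alpha> - unit_exp i) :: ('n, 'k) osi)"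
      by (metis monomial_add[of gx, OF gx_gx] monomial_unit_exp[of gx, OF gx_gx])
    then have "gy i * normal_form (Poly_Mapping.single \<alpha> p)
        = normal_form (Poly_Mapping.single (\<alpha> - unit_exp i) p)"
      by (simp add: normal_form_single flip: mult.assoc)
    then show ?thesis unfolding gen_y by blast
  qed
qed

lemma ex_normal_form: "\<exists>g. a = normal_form g"
proof (induction a rule: osi_induct)
  case zero
  show ?case by (metis normal_form_zero)
next
  case one
  show ?case
    by (metis normal_form_single monomial_zero[of gx, OF gx_gx] ypoly_one mult_1_left)
next
  case (add a b)
  then show ?case by (metis normal_form_add)
next
  case (scalar k a)
  then obtain g where a: "a = normal_form g" by blast
  have "\<exists>h. scalar k * normal_form g = normal_form h"
  proof (induction g rule: poly_mapping_additive_induct)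
    case (single \<alpha> p)
    have "scalar k * (monomial gx \<alpha> * ypoly p) = monomial gx \<alpha> * ypoly (Poly_Mapping.single 0 k * p)"
      by (simp add: ypoly_mult ypoly_scalar scalar_left_commute[of "monomial gx \<alpha>"])
    then show ?case by (metis normal_form_single)
  qed (metis mult_zero_right normal_form_zero, metis distrib_left normal_form_add)
  then show ?case by (simp add: a)
next
  case (gen e a)
  then obtain g where a: "a = normal_form g" by blast
  have "\<exists>h. gen_osi e * normal_form g = normal_form h"
    by (induction g rule: poly_mapping_additive_induct)
      (metis mult_zero_right normal_form_zero, rule gen_osi_normal_form_single,
        metis distrib_left normal_form_add)
  then show ?case by (simp add: a)
qed

text \<open>Applying an element to the coordinates of 1 returns its own coefficients, which makes
  normal forms unique and the action faithful.\<close>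

lemma reg_act_normal_form:
  "reg_act (normal_form g) (delta 0 1) \<alpha> = of_mpoly (Poly_Mapping.lookup g \<alpha>)"
proof (induction g rule: poly_mapping_additive_induct)
  case (single \<beta> p)
  show ?case
    by (simp add: normal_form_single reg_act_ypoly monomial_gx_delta)
      (simp add: delta_def lookup_single when_def)
qed (simp_all add: normal_form_add lookup_add)

lemma reg_act_delta_eq_0:
  assumes "reg_act a (delta 0 1) = 0"
  shows "a = 0"
proof -
  obtain g where g: "a = normal_form g" using ex_normal_form by blast
  have "of_mpoly (Poly_Mapping.lookup g \<alpha>) = 0" for \<alpha>
    using assms reg_act_normal_form[of g \<alpha>] by (simp add: g)
  then have "g = 0" by (intro poly_mapping_eqI) simp
  then show ?thesis by (simp add: g)
qed

text \<open>Applied to the coordinates of 1, the product becomes \<open>a\<close> acting on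
  \<open>delta 0 1\<close> scaled by the polynomial. The scalar is nonzero in the field K(y) and can
  be divided out.\<close>

lemma ypoly_left_regular:
  assumes "a * ypoly p = 0" "p \<noteq> 0"
  shows "a = 0"
proof -
  have "reg_act a (delta 0 (of_mpoly p)) = 0"
    using arg_cong[OF assms(1), of "\<lambda>b. reg_act b (delta 0 1)"] by (simp add: reg_act_ypoly)
  moreover have "delta 0 (of_mpoly p) = (\<lambda>\<alpha>. of_mpoly p * delta 0 1 \<alpha>)"
    by (simp add: delta_def fun_eq_iff)
  ultimately have "reg_act a (delta 0 1) = 0"
    using assms(2) by (simp add: reg_act_scale fun_eq_iff)
  then show ?thesis by (rule reg_act_delta_eq_0)
qed

lemma monomial_gy_nonzero: "monomial gy \<gamma> \<noteq> 0"
  by (simp flip: ypoly_monomial) (metis lookup_single_eq lookup_zero one_neq_zero)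

text \<open>After clearing the denominator of \<open>a\<close>, the value in K(y) is that of a
  polynomial, on which \<open>to_rat\<close> is injective. Conversely, a monomial in the
  \<open>y_i\<close> is nonzero in K(y), so it can be cancelled there.\<close>

lemma to_rat_eq_0_iff:
  fixes a :: "('n::linorder, 'k::field) osi"
  shows "to_rat a = 0 \<longleftrightarrow> (\<exists>\<gamma>. monomial gy \<gamma> * a = 0)"
proof
  assume a: "to_rat a = 0"
  obtain \<gamma> p where p: "monomial gy \<gamma> * a = ypoly p"
    using clear_denominator by blast
  have "of_mpoly p = to_rat (monomial gy \<gamma>) * to_rat a"
    by (metis p to_rat_simps(4) to_rat_ypoly)
  then show "\<exists>\<gamma>. monomial gy \<gamma> * a = 0" using a p by auto
next
  assume "\<exists>\<gamma>. monomial gy \<gamma> * a = 0"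
  then obtain \<gamma> where "monomial gy \<gamma> * a = 0" by blast
  then have "to_rat (monomial gy \<gamma>) * to_rat a = 0" by (metis to_rat_simps(1,4))
  moreover have "to_rat (monomial gy \<gamma> :: ('n, 'k) osi) \<noteq> 0"
    using monomial_gy_nonzero[of \<gamma>] by (metis ypoly_monomial to_rat_ypoly ypoly_eq_0_iff of_mpoly_eq_0_iff)
  ultimately show "to_rat a = 0" by simp
qed

lemma to_rat_left_regular:
  assumes "\<And>r. r * c = 0 \<Longrightarrow> r = 0"
  shows "to_rat c \<noteq> 0"
  using assms monomial_gy_nonzero by (auto simp: to_rat_eq_0_iff)

text \<open>
  After multiplication by a monomial in the \<open>y\<^sub>i\<close>, both elements lie in the commutative ring of
  polynomials in the \<open>y\<^sub>i\<close>.
\<close>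

lemma common_left_multiple:
  fixes r s :: "('n::linorder, 'k::field) osi"
  assumes "to_rat s \<noteq> 0"
  shows "\<exists>p q. p \<noteq> 0 \<and> ypoly p * r = ypoly q * s"
proof -
  obtain \<alpha> p where r: "monomial gy \<alpha> * r = ypoly p" using clear_denominator by blast
  obtain \<beta> q where s: "monomial gy \<beta> * s = ypoly q" using clear_denominator by blast
  have "q \<noteq> 0"
    using s assms by (auto simp: to_rat_eq_0_iff)
  moreover have "(Poly_Mapping.single \<alpha> 1 :: ('n, 'k) mpoly) \<noteq> 0"
    by (metis lookup_single_eq lookup_zero one_neq_zero)
  moreover have "ypoly (q * Poly_Mapping.single \<alpha> 1) * r = ypoly (p * Poly_Mapping.single \<beta> 1) * s"
    by (simp only: ypoly_mult ypoly_monomial mult.assoc r s) (rule ypoly_commute)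
  ultimately show ?thesis by (metis no_zero_divisors)
qed

section \<open>Transfer to the ring of cosets\<close>

lemma relator_coset_eq: "Idl\<^bsub>free_algebra\<^esub> relators +>\<^bsub>free_algebra\<^esub> a = {c. osi_rel c a}"
proof -
  have "c - a \<in> Idl\<^bsub>free_algebra\<^esub> relators \<longleftrightarrow> (\<exists>h \<in> Idl\<^bsub>free_algebra\<^esub> relators. c = h + a)" for c
    by (metis add_diff_cancel_right' diff_add_cancel)
  then show ?thesis
    by (auto simp: a_r_coset_def' osi_rel_def)
qed

text \<open>The bridge between the type and the ring record: injective by \<open>inj_coset\<close>
  and onto the carrier by \<open>carrier_SS\<close>.\<close>

lift_definition coset :: "('n::{finite,linorder}, 'k::field) osi \<Rightarrow> ('n, 'k) one_sided_inverses"
  is "\<lambda>a. Idl\<^bsub>free_algebra\<^esub> relators +>\<^bsub>free_algebra\<^esub> a"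
  unfolding relator_coset_eq using equivp_symp[OF osi_equivp] equivp_transp[OF osi_equivp] by blast

lemma inj_coset [simp]: "coset a = coset b \<longleftrightarrow> a = b"
  by transfer (auto simp: relator_coset_eq dest: equivp_symp[OF osi_equivp] equivp_transp[OF osi_equivp])

lemma coset_in_image [simp]: "coset a \<in> coset ` A \<longleftrightarrow> a \<in> A"
  by (auto simp: image_iff)

context
  fixes N :: "'n::{finite,linorder} itself" and K :: "'k::field itself"
begin

lemma carrier_SS: "carrier (SS N K) = range coset"
proof -
  have "carrier (SS N K) = range (\<lambda>a. Idl\<^bsub>free_algebra\<^esub> relators +>\<^bsub>free_algebra\<^esub> a)"
    by (auto simp: SS_def FactRing_def A_RCOSETS_def')
  also have "\<dots> = coset ` range abs_osi"
    by (simp add: coset.abs_eq image_image)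
  also have "range abs_osi = (UNIV :: ('n, 'k) osi set)"
  proof -
    have "a \<in> range abs_osi" for a :: "('n, 'k) osi"
      by (induction a rule: osi.abs_induct) simp
    then show ?thesis by blast
  qed
  finally show ?thesis .
qed

lemma coset_closed: "coset a \<in> carrier (SS N K)"
  by (simp add: carrier_SS)

lemma SS_simps [simp]:
  "coset a \<otimes>\<^bsub>SS N K\<^esub> coset b = coset (a * b)" "coset a \<oplus>\<^bsub>SS N K\<^esub> coset b = coset (a + b)"
  "\<one>\<^bsub>SS N K\<^esub> = coset 1" "\<zero>\<^bsub>SS N K\<^esub> = coset 0" "SS_gen g = coset (gen_osi g)"
  "k \<odot>\<^bsub>SS N K\<^esub> coset a = coset (scalar k * a)"
proof -
  let ?I = "Idl\<^bsub>free_algebra\<^esub> relators :: ('n gen free_monoid \<Rightarrow>\<^sub>0 'k) set"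
  interpret I: ideal ?I free_algebra by (rule ideal_relators)
  show "coset a \<otimes>\<^bsub>SS N K\<^esub> coset b = coset (a * b)"
    by transfer (simp add: SS_def FactRing_def I.rcoset_mult_add)
  show "coset a \<oplus>\<^bsub>SS N K\<^esub> coset b = coset (a + b)"
    by transfer (simp add: SS_def FactRing_def I.a_rcos_sum)
  show "\<one>\<^bsub>SS N K\<^esub> = coset 1"
    by transfer (simp add: SS_def FactRing_def)
  show "\<zero>\<^bsub>SS N K\<^esub> = coset 0"
    by transfer (simp add: SS_def FactRing_def relator_coset_eq, simp add: osi_rel_def)
  show "SS_gen g = coset (gen_osi g)"
    by transfer (simp add: SS_gen_def)
  show "k \<odot>\<^bsub>SS N K\<^esub> coset a = coset (scalar k * a)"
  proof (induction a rule: osi.abs_induct)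
    fix a :: "'n gen free_monoid \<Rightarrow>\<^sub>0 'k"
    \<comment> \<open>Scalar multiplication in the quotient is a union over all representatives; its
      members all coincide.\<close>
    have eq: "?I +>\<^bsub>free_algebra\<^esub> (Poly_Mapping.single 0 k * c) = ?I +>\<^bsub>free_algebra\<^esub> (Poly_Mapping.single 0 k * a)"
      if "osi_rel c a" for c
      using osi_rel_mult[OF osi_rel_refl that, of "Poly_Mapping.single 0 k"]
      unfolding relator_coset_eq
      using equivp_symp[OF osi_equivp] equivp_transp[OF osi_equivp] by blast
    have "k \<odot>\<^bsub>SS N K\<^esub> (?I +>\<^bsub>free_algebra\<^esub> a)
        = (\<Union>c \<in> ?I +>\<^bsub>free_algebra\<^esub> a. ?I +>\<^bsub>free_algebra\<^esub> (Poly_Mapping.single 0 k * c))"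
      unfolding SS_def quotient_algebra_def ring.defs module.defs by simp
    also have "\<dots> = ?I +>\<^bsub>free_algebra\<^esub> (Poly_Mapping.single 0 k * a)"
      using eq osi_rel_refl[of a] unfolding relator_coset_eq[of a] by blast
    finally show "k \<odot>\<^bsub>SS N K\<^esub> coset (abs_osi a) = coset (scalar k * abs_osi a)"
      by (simp add: coset.abs_eq scalar.abs_eq times_osi.abs_eq)
  qed
qed

lemma SS_minus [simp]:
  "\<ominus>\<^bsub>SS N K\<^esub> coset a = coset (- a)" "coset a \<ominus>\<^bsub>SS N K\<^esub> coset b = coset (a - b)"
proof -
  interpret ring "SS N K" by (rule ring_SS)
  show inv: "\<ominus>\<^bsub>SS N K\<^esub> coset a = coset (- a)" for a
    by (rule minus_equality) (auto simp: carrier_SS)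
  show "coset a \<ominus>\<^bsub>SS N K\<^esub> coset b = coset (a - b)"
    by (simp add: minus_eq inv)
qed

lemma YY_eq: "YY N K = range (\<lambda>p. coset (ypoly p))"
proof
  have "h \<in> range (\<lambda>p. coset (ypoly p))" if "h \<in> YY N K" for h
    using that unfolding YY_def
  proof (induction rule: generate_ring.induct)
    case one
    show ?case by (simp add: image_iff) (metis ypoly_one)
  next
    case (incl h)
    then show ?case
      by (auto simp: image_iff simp flip: ypoly_scalar ypoly_gy ypoly_mult)
  next
    case (a_inv h)
    then show ?case by (auto simp: simp flip: ypoly_uminus)
  next
    case (eng_add h1 h2)
    then show ?case by (auto simp flip: ypoly_add)
  next
    case (eng_mult h1 h2)
    then show ?case by (auto simp flip: ypoly_mult)
  qed
  then show "YY N K \<subseteq> range (\<lambda>p. coset (ypoly p))" by blast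
  have gy: "coset (gy i) \<in> YY N K" for i
    unfolding YY_def by (rule generate_ring.incl) (auto simp flip: SS_simps(5))
  have scalar: "coset (scalar k) \<in> YY N K" for k
    unfolding YY_def by (rule generate_ring.incl) (auto intro: exI[of _ k])
  have mult: "coset (a * b) \<in> YY N K" if "coset a \<in> YY N K" "coset b \<in> YY N K" for a b
    using generate_ring.eng_mult[OF that[unfolded YY_def]] by (simp add: YY_def)
  have add: "coset (a + b) \<in> YY N K" if "coset a \<in> YY N K" "coset b \<in> YY N K" for a b
    using generate_ring.eng_add[OF that[unfolded YY_def]] by (simp add: YY_def)
  have "coset (prod_list (map gy l)) \<in> YY N K" for l
  proof (induction l)
    case Nil
    show ?case using scalar[of 1] by simp
  qed (simp add: mult gy)
  then have "coset (ypoly p) \<in> YY N K" for p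
  proof (induction p rule: poly_mapping_additive_induct)
    case zero
    show ?case using scalar[of 0] by simp
  next
    case (single \<beta> k)
    then show ?case by (simp add: ypoly_single mult scalar monomial_def)
  qed (simp add: ypoly_add add)
  then show "range (\<lambda>p. coset (ypoly p)) \<subseteq> YY N K" by blast
qed

section \<open>The ideal \<open>aa\<close> as the kernel of \<open>to_rat\<close>\<close>

lemma ideal_ker_to_rat: "ideal (coset ` {a. to_rat a = 0}) (SS N K)"
proof (rule idealI[OF ring_SS])
  interpret ring "SS N K" by (rule ring_SS)
  show "subgroup (coset ` {a. to_rat a = 0}) (add_monoid (SS N K))"
    by (rule add.subgroupI) (auto simp: carrier_SS intro!: imageI exI[of _ 0])
qed (auto simp: carrier_SS intro!: imageI)

text \<open>The generators \<open>1 - x_i y_i\<close> vanish in K(y), which gives one inclusion.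
  Conversely, an element of the kernel is annihilated by a monomial in the \<open>y_i\<close>, and
  modulo \<open>aa\<close> each \<open>y_i\<close> can be cancelled on the left because
  \<open>b = x_i (y_i b) + (1 - x_i y_i) b\<close>.\<close>

lemma aa_eq: "aa N K = coset ` {a. to_rat a = 0}"
proof
  interpret ring "SS N K" by (rule ring_SS)
  let ?J = "coset ` {a. to_rat a = 0} :: ('n, 'k) one_sided_inverses set"
  interpret J: ideal ?J "SS N K" by (rule ideal_ker_to_rat)
  have pp: "pp N K i \<subseteq> ?J" for i
    unfolding pp_def by (rule genideal_minimal[OF ideal_ker_to_rat]) simp
  have "(\<Oplus>\<^bsub>SS N K\<^esub>i\<in>A. f i) \<in> ?J" if f: "\<forall>i. f i \<in> pp N K i" and "finite A" for f and A :: "'n set"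
    using that(2)
  proof (induction A)
    case empty
    have "coset 0 \<in> ?J" by (rule imageI) simp
    then show ?case by simp
  next
    case (insert i A)
    have "f j \<in> carrier (SS N K)" for j
      using ideal.Icarr[OF ideal_pp] f by blast
    then have "(\<Oplus>\<^bsub>SS N K\<^esub>j\<in>insert i A. f j) = f i \<oplus>\<^bsub>SS N K\<^esub> (\<Oplus>\<^bsub>SS N K\<^esub>j\<in>A. f j)"
      using insert.hyps by (intro finsum_insert) auto
    moreover have "f i \<in> ?J" using pp f by blast
    ultimately show ?case
      using additive_subgroup.a_closed[OF J.is_additive_subgroup _ insert.IH] by simp
  qed
  then show "aa N K \<subseteq> ?J"
    by (auto dest!: aaE)
  interpret A: ideal "aa N K" "SS N K" by (rule ideal_aa)
  have e: "coset (1 - gx i * gy i) \<in> aa N K" for i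
  proof -
    have pp: "coset (1 - gx i * gy i) \<in> pp N K i"
      unfolding pp_def using genideal_self'[of "coset (1 - gx i * gy i)"] by (simp add: carrier_SS)
    \<comment> \<open>A single element of \<open>pp N K i\<close> belongs to the sum of ideals
      through the family that is zero at all other indices.\<close>
    let ?f = "\<lambda>j. if j = i then coset (1 - gx i * gy i) else \<zero>\<^bsub>SS N K\<^esub>"
    have "(\<Oplus>\<^bsub>SS N K\<^esub>j\<in>UNIV. ?f j) \<in> aa N K"
      using pp additive_subgroup.zero_closed[OF ideal.axioms(1)[OF ideal_pp]]
      by (intro aaI) (auto simp del: SS_simps(4))
    also have "(\<Oplus>\<^bsub>SS N K\<^esub>j\<in>UNIV. ?f j) = coset (1 - gx i * gy i)"
      using finsum_singleton[of i UNIV "\<lambda>_. coset (1 - gx i * gy i)"]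
      by (simp add: carrier_SS eq_commute)
    finally show ?thesis .
  qed
  have gy: "coset b \<in> aa N K" if "coset (gy i * b) \<in> aa N K" for i b
  proof -
    have "coset (gx i * (gy i * b)) \<in> aa N K"
      using A.I_l_closed[OF that, of "coset (gx i)"] by (simp add: carrier_SS)
    moreover have "coset ((1 - gx i * gy i) * b) \<in> aa N K"
      using A.I_r_closed[OF e, of "coset b"] by (simp add: carrier_SS)
    ultimately have "coset (gx i * (gy i * b) + (1 - gx i * gy i) * b) \<in> aa N K"
      by (metis SS_simps(2) additive_subgroup.a_closed[OF A.is_additive_subgroup])
    then show ?thesis by (simp add: algebra_simps)
  qed
  have mono: "coset (prod_list (map gy l) * b) \<in> aa N K \<Longrightarrow> coset b \<in> aa N K" for l b
    by (induction l) (auto simp: mult.assoc dest: gy)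
  show "?J \<subseteq> aa N K"
  proof clarify
    fix a :: "('n, 'k) osi"
    assume "to_rat a = 0"
    then obtain \<gamma> where "monomial gy \<gamma> * a = 0" by (auto simp: to_rat_eq_0_iff)
    moreover have "coset 0 \<in> aa N K"
      using additive_subgroup.zero_closed[OF A.is_additive_subgroup] by simp
    ultimately have "coset (prod_list (map gy (letters_of \<gamma>)) * a) \<in> aa N K"
      by (simp only: monomial_def)
    then show "coset a \<in> aa N K" by (rule mono)
  qed
qed

section \<open>The remaining sets of the theorem in terms of the type \<open>osi\<close>\<close>

lemma left_regular_SS: "left_regular (SS N K) = coset ` {c. \<forall>r. r * c = 0 \<longrightarrow> r = 0}"
  by (auto simp: left_regular_def carrier_SS)

lemma T_set_SS: "T_set N K = coset ` {a. to_rat a \<noteq> 0}"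
  by (auto simp: T_set_eq carrier_SS aa_eq)

text \<open>Subtracting the polynomial with the same value in K(y) leaves an element of the kernel
  \<open>aa\<close>.\<close>

lemma S_set_SS: "S_set N K = coset ` {a. \<exists>p. p \<noteq> 0 \<and> to_rat a = of_mpoly p}"
proof
  show "S_set N K \<subseteq> coset ` {a. \<exists>p. p \<noteq> 0 \<and> to_rat a = of_mpoly p}"
    by (auto simp: S_set_eq YY_eq aa_eq set_add_def')
  show "coset ` {a. \<exists>p. p \<noteq> 0 \<and> to_rat a = of_mpoly p} \<subseteq> S_set N K"
  proof clarify
    fix a :: "('n, 'k) osi" and p :: "('n, 'k) mpoly"
    assume "p \<noteq> 0" "to_rat a = of_mpoly p"
    then have "coset (ypoly p) \<in> YY N K - {\<zero>\<^bsub>SS N K\<^esub>}" "coset (a - ypoly p) \<in> aa N K"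
      by (auto simp: YY_eq aa_eq)
    moreover have "coset a = coset (ypoly p) \<oplus>\<^bsub>SS N K\<^esub> coset (a - ypoly p)"
      by simp
    ultimately show "coset a \<in> S_set N K"
      unfolding S_set_eq set_add_def' by blast
  qed
qed

end

section \<open>Localizations with field of fractions \<open>K(y)\<close>\<close>

text \<open>An algebra isomorphism written as a parametrization by K(y). Two parametrized algebras
  are then isomorphic by composing one parametrization with the inverse of the other.\<close>

definition ratfun_coordinates ::
    "('k::field, 'a, 'm) module_scheme \<Rightarrow> (('n::linorder, 'k) ratfun \<Rightarrow> 'a) \<Rightarrow> bool" where
  "ratfun_coordinates A c \<longleftrightarrow> inj c \<and> carrier A = range c \<and> c 1 = \<one>\<^bsub>A\<^esub> \<and>
    (\<forall>p q. c (p * q) = c p \<otimes>\<^bsub>A\<^esub> c q) \<and> (\<forall>p q. c (p + q) = c p \<oplus>\<^bsub>A\<^esub> c q) \<and>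
    (\<forall>k q. c (const k * q) = k \<odot>\<^bsub>A\<^esub> c q)"

lemma algebra_iso_if_ratfun_coordinates:
  fixes c :: "('n::linorder, 'k::field) ratfun \<Rightarrow> 'a" and d :: "('n, 'k) ratfun \<Rightarrow> 'b"
  assumes c: "ratfun_coordinates A c" and d: "ratfun_coordinates B d"
  shows "A \<simeq>\<^sub>K B"
proof -
  define h where "h = d \<circ> inv_into UNIV c"
  have h: "h (c q) = d q" for q
    using c by (simp add: h_def ratfun_coordinates_def)
  have "bij_betw h (carrier A) (carrier B)"
    unfolding bij_betw_def inj_on_def using c d by (auto simp: ratfun_coordinates_def h inj_eq image_iff)
  moreover have "h \<in> ring_hom A B"
  proof (rule ring_hom_memI)
    show "h \<one>\<^bsub>A\<^esub> = \<one>\<^bsub>B\<^esub>" using c d h by (metis ratfun_coordinates_def)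
  next
    fix x y assume "x \<in> carrier A" "y \<in> carrier A"
    then obtain p q where "x = c p" "y = c q" using c by (auto simp: ratfun_coordinates_def)
    then show "h (x \<otimes>\<^bsub>A\<^esub> y) = h x \<otimes>\<^bsub>B\<^esub> h y" "h (x \<oplus>\<^bsub>A\<^esub> y) = h x \<oplus>\<^bsub>B\<^esub> h y"
      using c d h by (metis ratfun_coordinates_def)+
  next
    fix x assume "x \<in> carrier A"
    then show "h x \<in> carrier B" using c d by (auto simp: ratfun_coordinates_def h)
  qed
  moreover have "h (k \<odot>\<^bsub>A\<^esub> a) = k \<odot>\<^bsub>B\<^esub> h a" if "a \<in> carrier A" for k a
    using that c d h by (auto simp: ratfun_coordinates_def) (metis h)
  ultimately show ?thesis
    by (auto simp: algebra_iso_def ring_iso_def)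
qed

lemma ratfun_coordinates_rational_functions:
  fixes N :: "'n::{finite,linorder} itself" and K :: "'k::field itself"
  shows "ratfun_coordinates (rational_functions N K) id"
  by (simp add: ratfun_coordinates_def rational_functions_def ring_of_type_algebra_def ring.defs
    module.defs const_def of_mpoly_def)

text \<open>Multiplicative sets between the nonzero polynomials in the \<open>y_i\<close> and the
  complement of the kernel of \<open>to_rat\<close>. All four denominator sets of the theorem are
  instances.\<close>

locale denominators =
  fixes D :: "('n::{finite,linorder}, 'k::field) osi set"
  assumes one: "1 \<in> D" and mult: "a \<in> D \<Longrightarrow> b \<in> D \<Longrightarrow> a * b \<in> D"
    and ypoly: "p \<noteq> 0 \<Longrightarrow> ypoly p \<in> D" and nonzero: "d \<in> D \<Longrightarrow> to_rat d \<noteq> 0"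
begin

lemma monomial_in: "monomial gy \<gamma> \<in> D"
  unfolding ypoly_monomial[symmetric]
  by (rule ypoly) (metis lookup_single_eq lookup_zero one_neq_zero)

lemma Ore: "s \<in> D \<Longrightarrow> \<exists>t a. t \<in> D \<and> t * r = a * s"
  using common_left_multiple[OF nonzero, of s r] ypoly by blast

context
  fixes N :: "'n itself" and K :: "'k itself"
begin

lemma in_Den_l: "coset ` D \<in> Den_l (SS N K) (aa N K)"
proof -
  \<comment> \<open>Annihilation by an element of \<open>D\<close> amounts to vanishing in K(y).
    This computes \<open>ass_l\<close> and, since K(y) has no zero divisors, also gives the
    denominator condition.\<close>
  have kernel: "(\<exists>t\<in>D. t * r = 0) \<longleftrightarrow> to_rat r = 0" for r
  proof
    assume "\<exists>t\<in>D. t * r = 0"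
    then obtain t where "t \<in> D" "t * r = 0" by blast
    then have "to_rat t * to_rat r = 0" by (metis to_rat_simps(1,4))
    then show "to_rat r = 0" using nonzero[OF \<open>t \<in> D\<close>] by simp
  qed (auto simp: to_rat_eq_0_iff intro: monomial_in)
  have "multiplicative_set (SS N K) (coset ` D)"
    using one mult nonzero[of 0] by (auto simp: multiplicative_set_def carrier_SS)
  moreover have "\<exists>t a. t \<in> D \<and> coset t \<otimes>\<^bsub>SS N K\<^esub> coset r = coset a \<otimes>\<^bsub>SS N K\<^esub> coset s" if "s \<in> D" for r s
    using Ore[OF that] by simp
  ultimately have "left_Ore_set (SS N K) (coset ` D)"
    unfolding left_Ore_set_def carrier_SS by fast
  moreover have "\<exists>t\<in>D. t * r = 0" if "s \<in> D" "r * s = 0" for r s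
  proof -
    have "to_rat r * to_rat s = 0" using that by (metis to_rat_simps(1,4))
    then show ?thesis using nonzero[OF that(1)] by (simp add: kernel)
  qed
  ultimately have "left_denominator_set (SS N K) (coset ` D)"
    by (auto simp: left_denominator_set_def carrier_SS)
  moreover have "ass_l (SS N K) (coset ` D) = aa N K"
    by (auto simp: ass_l_def carrier_SS aa_eq simp flip: kernel)
  ultimately show ?thesis by (simp add: Den_l_def)
qed

text \<open>All left fractions with value \<open>q\<close> in K(y), the value condition being stated
  without division.\<close>

definition fraction_class :: "('n, 'k) ratfun \<Rightarrow> (('n, 'k) one_sided_inverses \<times> ('n, 'k) one_sided_inverses) set" where
  "fraction_class q = {(coset s, coset r) | s r. s \<in> D \<and> to_rat r = to_rat s * q}"

lemma fraction_classI: "s \<in> D \<Longrightarrow> to_rat r = to_rat s * q \<Longrightarrow> (coset s, coset r) \<in> fraction_class q"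
  by (auto simp: fraction_class_def)

text \<open>A common expansion preserves the value: its denominator is nonzero in K(y), which forces
  \<open>to_rat d \<noteq> 0\<close>. Conversely, for equal values a common left multiple of the
  denominators makes the numerators agree up to the kernel, and one more monomial in the
  \<open>y_i\<close> removes the difference.\<close>

lemma left_fraction_eq:
  assumes s: "s \<in> D" and q: "to_rat r = to_rat s * q"
  shows "left_fraction (SS N K) (coset ` D) (coset s) (coset r) = fraction_class q"
proof -
  have "s' \<in> D \<and> (\<exists>c d. c * s = d * s' \<and> c * s \<in> D \<and> c * r = d * r') \<longleftrightarrow>
      s' \<in> D \<and> to_rat r' = to_rat s' * q" for s' r'
  proof (intro conj_cong refl iffI)
    assume s': "s' \<in> D"
    {
      assume "\<exists>c d. c * s = d * s' \<and> c * s \<in> D \<and> c * r = d * r'"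
      then obtain c d where cd: "c * s = d * s'" "c * s \<in> D" "c * r = d * r'" by blast
      have s: "to_rat c * to_rat s = to_rat d * to_rat s'" and r: "to_rat c * to_rat r = to_rat d * to_rat r'"
        using arg_cong[OF cd(1), of to_rat] arg_cong[OF cd(3), of to_rat] by simp_all
      have "to_rat d * to_rat r' = (to_rat c * to_rat s) * q"
        by (simp add: q mult.assoc flip: r)
      then have "to_rat d * to_rat r' = to_rat d * (to_rat s' * q)"
        by (simp only: s mult.assoc)
      moreover have "to_rat d \<noteq> 0"
        using nonzero[OF cd(2)] s by auto
      ultimately show "to_rat r' = to_rat s' * q" by simp
    }
    assume q': "to_rat r' = to_rat s' * q"
    obtain p p' where p: "p \<noteq> 0" "ypoly p * s = ypoly p' * s'"
      using common_left_multiple[OF nonzero[OF s'], of s] by blast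
    have "to_rat (ypoly p * r - ypoly p' * r') = (to_rat (ypoly p * s) - to_rat (ypoly p' * s')) * q"
      by (simp add: q q' algebra_simps)
    then have "to_rat (ypoly p * r - ypoly p' * r') = 0" by (simp only: p(2)) simp
    then obtain \<gamma> where "monomial gy \<gamma> * (ypoly p * r - ypoly p' * r') = 0"
      unfolding to_rat_eq_0_iff by blast
    then have "monomial gy \<gamma> * ypoly p * r = monomial gy \<gamma> * ypoly p' * r'"
      by (simp add: right_diff_distrib mult.assoc)
    moreover have "monomial gy \<gamma> * ypoly p * s = monomial gy \<gamma> * ypoly p' * s'"
      by (simp add: mult.assoc p(2))
    moreover have "monomial gy \<gamma> * ypoly p * s \<in> D"
      by (intro mult monomial_in ypoly p s)
    ultimately show "\<exists>c d. c * s = d * s' \<and> c * s \<in> D \<and> c * r = d * r'" by blast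
  qed
  moreover have "left_fraction (SS N K) (coset ` D) (coset s) (coset r) =
      {(coset s', coset r') | s' r'. s' \<in> D \<and> (\<exists>c d. c * s = d * s' \<and> c * s \<in> D \<and> c * r = d * r')}"
    by (auto simp: left_fraction_def carrier_SS) metis+
  ultimately show ?thesis
    by (simp only: fraction_class_def)
qed

lemma ex_fraction: "\<exists>s r. s \<in> D \<and> to_rat r = to_rat s * q"
proof (cases q rule: Fract_cases)
  case (Fract u v)
  then have "to_rat (ypoly u) = to_rat (ypoly v) * q"
    by (simp add: of_mpoly_def eq_fract)
  then show ?thesis using ypoly Fract by blast
qed

lemma Union_eq: "A \<noteq> {} \<Longrightarrow> (\<And>C. C \<in> A \<Longrightarrow> C = B) \<Longrightarrow> \<Union>A = B"
  by blast

text \<open>Classes are determined by their values in K(y), so each operation needs two facts: every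
  admissible choice of representatives and multipliers yields the expected value, and some choice
  exists. The second keeps the unions nonempty.\<close>

lemma ratfun_coordinates_left_localization:
  "ratfun_coordinates (left_localization (SS N K) (coset ` D)) fraction_class"
proof -
  let ?L = "left_localization (SS N K) (coset ` D)"
  have "inj fraction_class"
  proof (rule injI)
    fix p q assume eq: "fraction_class p = fraction_class q"
    obtain s r where sr: "s \<in> D" "to_rat r = to_rat s * p" using ex_fraction by blast
    then have "(coset s, coset r) \<in> fraction_class q"
      unfolding eq[symmetric] by (auto simp: fraction_class_def)
    then have "to_rat s * p = to_rat s * q"
      using sr by (auto simp: fraction_class_def)
    then show "p = q" using nonzero[OF sr(1)] by simp
  qed
  moreover have "carrier ?L = range fraction_class"
  proof
    show "carrier ?L \<subseteq> range fraction_class"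
    proof
      fix x assume "x \<in> carrier ?L"
      then obtain s r where "s \<in> D" "x = left_fraction (SS N K) (coset ` D) (coset s) (coset r)"
        by (auto simp: left_localization_def carrier_SS)
      then show "x \<in> range fraction_class"
        using left_fraction_eq[of s r "to_rat r / to_rat s"] nonzero[of s] by auto
    qed
    show "range fraction_class \<subseteq> carrier ?L"
    proof clarify
      fix q
      obtain s r where "s \<in> D" "to_rat r = to_rat s * q" using ex_fraction by blast
      then show "fraction_class q \<in> carrier ?L"
        using left_fraction_eq by (fastforce simp: left_localization_def carrier_SS)
    qed
  qed
  moreover have "fraction_class 1 = \<one>\<^bsub>?L\<^esub>"
    using left_fraction_eq[OF one, of 1 1] by (simp add: left_localization_def)
  moreover have "fraction_class (p * q) = fraction_class p \<otimes>\<^bsub>?L\<^esub> fraction_class q" for p q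
  proof -
    obtain s\<^sub>1 r\<^sub>1 where 1: "s\<^sub>1 \<in> D" "to_rat r\<^sub>1 = to_rat s\<^sub>1 * p" using ex_fraction by blast
    obtain s\<^sub>2 r\<^sub>2 where 2: "s\<^sub>2 \<in> D" "to_rat r\<^sub>2 = to_rat s\<^sub>2 * q" using ex_fraction by blast
    obtain t a where ta: "t \<in> D" "t * r\<^sub>1 = a * s\<^sub>2" using Ore[OF 2(1)] by blast
    have class_eq: "left_fraction (SS N K) (coset ` D) (coset t \<otimes>\<^bsub>SS N K\<^esub> coset s\<^sub>1) (coset a \<otimes>\<^bsub>SS N K\<^esub> coset r\<^sub>2)
        = fraction_class (p * q)"
      if "s\<^sub>1 \<in> D" "to_rat r\<^sub>1 = to_rat s\<^sub>1 * p" "s\<^sub>2 \<in> D" "to_rat r\<^sub>2 = to_rat s\<^sub>2 * q"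
        "t \<in> D" "t * r\<^sub>1 = a * s\<^sub>2" for s\<^sub>1 r\<^sub>1 s\<^sub>2 r\<^sub>2 t a
    proof -
      have "to_rat t * to_rat r\<^sub>1 = to_rat a * to_rat s\<^sub>2"
        using that(6) by (metis to_rat_simps(4))
      then have "to_rat (a * r\<^sub>2) = to_rat (t * s\<^sub>1) * (p * q)"
        using that by (simp add: mult_ac)
      then show ?thesis
        using that by (simp add: left_fraction_eq mult)
    qed
    show ?thesis
      unfolding left_localization_def monoid.simps
    proof (rule Union_eq[symmetric])
      show "{left_fraction (SS N K) (coset ` D) (t \<otimes>\<^bsub>SS N K\<^esub> s\<^sub>1) (a \<otimes>\<^bsub>SS N K\<^esub> r\<^sub>2) | s\<^sub>1 r\<^sub>1 s\<^sub>2 r\<^sub>2 t a.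
          (s\<^sub>1, r\<^sub>1) \<in> fraction_class p \<and> (s\<^sub>2, r\<^sub>2) \<in> fraction_class q \<and> t \<in> coset ` D \<and>
          a \<in> carrier (SS N K) \<and> t \<otimes>\<^bsub>SS N K\<^esub> r\<^sub>1 = a \<otimes>\<^bsub>SS N K\<^esub> s\<^sub>2} \<noteq> {}"
        unfolding Collect_empty_eq not_all not_not
        by (intro exI conjI, rule refl, rule fraction_classI[OF 1], rule fraction_classI[OF 2],
          rule imageI[OF ta(1)], rule coset_closed[of a]) (simp add: ta)
    qed (use class_eq in \<open>force simp: fraction_class_def carrier_SS\<close>)
  qed
  moreover have "fraction_class (p + q) = fraction_class p \<oplus>\<^bsub>?L\<^esub> fraction_class q" for p q
  proof -
    obtain s\<^sub>1 r\<^sub>1 where 1: "s\<^sub>1 \<in> D" "to_rat r\<^sub>1 = to_rat s\<^sub>1 * p" using ex_fraction by blast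
    obtain s\<^sub>2 r\<^sub>2 where 2: "s\<^sub>2 \<in> D" "to_rat r\<^sub>2 = to_rat s\<^sub>2 * q" using ex_fraction by blast
    \<comment> \<open>The Ore condition for the two denominators gives a common one;
      \<open>c\<close> itself lies in \<open>D\<close>, hence so does
      \<open>c * s\<^sub>1\<close>.\<close>
    obtain c d where cd: "c \<in> D" "c * s\<^sub>1 = d * s\<^sub>2" using Ore[OF 2(1)] by blast
    then have cs: "c * s\<^sub>1 \<in> D" using 1 mult by blast
    have class_eq: "left_fraction (SS N K) (coset ` D) (coset c \<otimes>\<^bsub>SS N K\<^esub> coset s\<^sub>1)
        (coset c \<otimes>\<^bsub>SS N K\<^esub> coset r\<^sub>1 \<oplus>\<^bsub>SS N K\<^esub> coset d \<otimes>\<^bsub>SS N K\<^esub> coset r\<^sub>2) = fraction_class (p + q)"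
      if "s\<^sub>1 \<in> D" "to_rat r\<^sub>1 = to_rat s\<^sub>1 * p" "s\<^sub>2 \<in> D" "to_rat r\<^sub>2 = to_rat s\<^sub>2 * q"
        "c * s\<^sub>1 = d * s\<^sub>2" "c * s\<^sub>1 \<in> D" for s\<^sub>1 r\<^sub>1 s\<^sub>2 r\<^sub>2 c d
    proof -
      have "to_rat c * to_rat s\<^sub>1 = to_rat d * to_rat s\<^sub>2"
        using that(5) by (metis to_rat_simps(4))
      then have "to_rat (c * r\<^sub>1 + d * r\<^sub>2) = to_rat (c * s\<^sub>1) * (p + q)"
        using that by (simp add: distrib_left flip: mult.assoc)
      then show ?thesis
        using that by (simp add: left_fraction_eq)
    qed
    show ?thesis
      unfolding left_localization_def ring.simps
    proof (rule Union_eq[symmetric])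
      show "{left_fraction (SS N K) (coset ` D) (c \<otimes>\<^bsub>SS N K\<^esub> s\<^sub>1) (c \<otimes>\<^bsub>SS N K\<^esub> r\<^sub>1 \<oplus>\<^bsub>SS N K\<^esub> d \<otimes>\<^bsub>SS N K\<^esub> r\<^sub>2)
          | s\<^sub>1 r\<^sub>1 s\<^sub>2 r\<^sub>2 c d. (s\<^sub>1, r\<^sub>1) \<in> fraction_class p \<and> (s\<^sub>2, r\<^sub>2) \<in> fraction_class q \<and>
          c \<in> carrier (SS N K) \<and> d \<in> carrier (SS N K) \<and>
          c \<otimes>\<^bsub>SS N K\<^esub> s\<^sub>1 = d \<otimes>\<^bsub>SS N K\<^esub> s\<^sub>2 \<and> c \<otimes>\<^bsub>SS N K\<^esub> s\<^sub>1 \<in> coset ` D} \<noteq> {}"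
        unfolding Collect_empty_eq not_all not_not
        by (intro exI conjI, rule refl, rule fraction_classI[OF 1], rule fraction_classI[OF 2],
          rule coset_closed[of c], rule coset_closed[of d]) (use cd(2) cs in simp_all)
    qed (use class_eq in \<open>force simp: fraction_class_def carrier_SS\<close>)
  qed
  moreover have "fraction_class (const k * q) = k \<odot>\<^bsub>?L\<^esub> fraction_class q" for k q
  proof -
    obtain s r where sr: "s \<in> D" "to_rat r = to_rat s * q" using ex_fraction by blast
    have class_eq: "left_fraction (SS N K) (coset ` D) (coset s) (k \<odot>\<^bsub>SS N K\<^esub> coset r) = fraction_class (const k * q)"
      if "s \<in> D" "to_rat r = to_rat s * q" for s r
      using that by (simp add: left_fraction_eq)
    show ?thesis
      unfolding left_localization_def module.simps
    proof (rule Union_eq[symmetric])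
      show "{left_fraction (SS N K) (coset ` D) s (k \<odot>\<^bsub>SS N K\<^esub> r) | s r. (s, r) \<in> fraction_class q} \<noteq> {}"
        using fraction_classI[OF sr] by blast
    qed (use class_eq in \<open>force simp: fraction_class_def\<close>)
  qed
  ultimately show ?thesis by (simp add: ratfun_coordinates_def)
qed

end

end

section \<open>The denominator sets of the theorem\<close>

lemma denominators_ypoly: "denominators (ypoly ` {p. p \<noteq> 0})"
proof
  show "1 \<in> ypoly ` {p. p \<noteq> 0}"
    by (rule image_eqI[of _ _ 1]) simp_all
next
  fix a b :: "('a, 'b) osi" assume "a \<in> ypoly ` {p. p \<noteq> 0}" "b \<in> ypoly ` {p. p \<noteq> 0}"
  then obtain p q where "p \<noteq> 0" "a = ypoly p" "q \<noteq> 0" "b = ypoly q" by blast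
  then show "a * b \<in> ypoly ` {p. p \<noteq> 0}"
    by (metis (mono_tags, lifting) image_eqI mem_Collect_eq no_zero_divisors ypoly_mult)
qed auto

lemma denominators_left_regular: "denominators {c. \<forall>r. r * c = 0 \<longrightarrow> r = 0}"
proof
  show "a * b \<in> {c. \<forall>r. r * c = 0 \<longrightarrow> r = 0}"
    if "a \<in> {c. \<forall>r. r * c = 0 \<longrightarrow> r = 0}" "b \<in> {c. \<forall>r. r * c = 0 \<longrightarrow> r = 0}" for a b :: "('a, 'b) osi"
  proof clarify
    fix r assume "r * (a * b) = 0"
    then have "r * a * b = 0" by (simp only: mult.assoc)
    then have "r * a = 0" using that(2) by blast
    then show "r = 0" using that(1) by blast
  qed
next
  show "ypoly p \<in> {c. \<forall>r. r * c = 0 \<longrightarrow> r = 0}" if "p \<noteq> 0" for p :: "('a, 'b) mpoly"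
    using ypoly_left_regular[OF _ that] by blast
next
  show "to_rat d \<noteq> 0" if "d \<in> {c. \<forall>r. r * c = 0 \<longrightarrow> r = 0}" for d :: "('a, 'b) osi"
    using to_rat_left_regular[of d] that by blast
qed simp

lemma denominators_to_rat_nonzero: "denominators {a. to_rat a \<noteq> 0}"
  by standard simp_all

lemma denominators_to_rat_of_mpoly: "denominators {a. \<exists>p. p \<noteq> 0 \<and> to_rat a = of_mpoly p}"
proof
  show "a * b \<in> {a. \<exists>p. p \<noteq> 0 \<and> to_rat a = of_mpoly p}"
    if ab: "a \<in> {a. \<exists>p. p \<noteq> 0 \<and> to_rat a = of_mpoly p}" "b \<in> {a. \<exists>p. p \<noteq> 0 \<and> to_rat a = of_mpoly p}"
    for a b :: "('a, 'b) osi"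
  proof -
    obtain p q where "p \<noteq> 0" "to_rat a = of_mpoly p" "q \<noteq> 0" "to_rat b = of_mpoly q"
      using ab by blast
    then have "p * q \<noteq> 0 \<and> to_rat (a * b) = of_mpoly (p * q)" by simp
    then show ?thesis by blast
  qed
qed (auto intro: exI[of _ 1])

text \<open>The upper bound \<open>left_regular\<close> is attained, being itself a left denominator
  set.\<close>

lemma largest_left_regular_denominator_set_SS:
  fixes N :: "'n::{finite,linorder} itself" and K :: "'k::field itself"
  shows "largest_left_regular_denominator_set (SS N K) = left_regular (SS N K)"
  unfolding largest_left_regular_denominator_set_def
proof (rule Greatest_equality)
  show "left_denominator_set (SS N K) (left_regular (SS N K)) \<and> left_regular (SS N K) \<subseteq> left_regular (SS N K)"
    using denominators.in_Den_l[OF denominators_left_regular, of N K]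
    by (simp add: left_regular_SS Den_l_def)
qed simp

lemma YY_inter_left_regular: "YY N K \<inter> left_regular (SS N K) = coset ` ypoly ` {p. p \<noteq> 0}"
proof -
  have "coset (ypoly p) \<in> left_regular (SS N K) \<longleftrightarrow> p \<noteq> 0" for p
    \<comment> \<open>Instantiating left regularity at 1 excludes zero, as
      \<open>1 * 0 = 0\<close>.\<close>
    by (auto simp: left_regular_SS dest: ypoly_left_regular spec[of _ 1])
  then show ?thesis
    by (auto simp: YY_eq)
qed

lemma YY'_eq: "YY' N K = coset ` ypoly ` {p. p \<noteq> 0}"
  by (simp add: YY'_def largest_left_regular_denominator_set_SS YY_inter_left_regular)

theorem theorem3p11:
  fixes N :: "'n::{finite,linorder} itself" and K :: "'k::field itself"
  shows
    "left_regular_left_quotient_ring (SS N K) \<simeq>\<^sub>K rational_functions N K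
     \<and>
     YY' N K \<in> Den_l (SS N K) (aa N K) \<and>
     left_localization (SS N K) (YY' N K) \<simeq>\<^sub>K left_regular_left_quotient_ring (SS N K) \<and>
     multiplicative_set (SS N K) (YY N K \<inter> left_regular (SS N K)) \<and>
     left_denominator_set (SS N K) (YY' N K) \<and>
     YY' N K \<subseteq> YY N K \<inter> left_regular (SS N K) \<and>
     (\<forall>D. left_denominator_set (SS N K) D \<and> D \<subseteq> YY N K \<inter> left_regular (SS N K)
        \<longrightarrow> D \<subseteq> YY' N K)
     \<and>
     S_set N K \<in> Den_l (SS N K) (aa N K) \<and>
     T_set N K \<in> Den_l (SS N K) (aa N K) \<and>
     left_localization (SS N K) (YY' N K) \<simeq>\<^sub>K left_localization (SS N K) (T_set N K) \<and>
     left_localization (SS N K) (T_set N K) \<simeq>\<^sub>K left_localization (SS N K) (S_set N K) \<and>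
     left_localization (SS N K) (S_set N K) \<simeq>\<^sub>K rational_functions N K"
proof -
  note rat = ratfun_coordinates_rational_functions[of N K]
  note loc = denominators.ratfun_coordinates_left_localization
  \<comment> \<open>All four localizations are parametrized by the same field K(y); the isomorphisms
    then follow pairwise.\<close>
  obtain y :: "('n, 'k) ratfun \<Rightarrow> _" where Y: "ratfun_coordinates (left_localization (SS N K) (YY' N K)) y"
    unfolding YY'_eq using loc[OF denominators_ypoly] by blast
  obtain q :: "('n, 'k) ratfun \<Rightarrow> _" where Q: "ratfun_coordinates (left_regular_left_quotient_ring (SS N K)) q"
    unfolding left_regular_left_quotient_ring_def largest_left_regular_denominator_set_SS left_regular_SS
    using loc[OF denominators_left_regular] by blast
  obtain t :: "('n, 'k) ratfun \<Rightarrow> _" where T: "ratfun_coordinates (left_localization (SS N K) (T_set N K)) t"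
    unfolding T_set_SS using loc[OF denominators_to_rat_nonzero] by blast
  obtain s :: "('n, 'k) ratfun \<Rightarrow> _" where S: "ratfun_coordinates (left_localization (SS N K) (S_set N K)) s"
    unfolding S_set_SS using loc[OF denominators_to_rat_of_mpoly] by blast
  have YDen: "YY' N K \<in> Den_l (SS N K) (aa N K)"
    unfolding YY'_eq by (rule denominators.in_Den_l[OF denominators_ypoly])
  then have Yden: "left_denominator_set (SS N K) (YY' N K)"
    by (simp add: Den_l_def)
  \<comment> \<open>With this equality, maximality among the left denominator sets inside the
    intersection is immediate.\<close>
  have Yreg: "YY N K \<inter> left_regular (SS N K) = YY' N K"
    by (simp add: YY'_eq YY_inter_left_regular)
  have "multiplicative_set (SS N K) (YY' N K)"
    using Yden by (simp add: left_denominator_set_def left_Ore_set_def)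
  moreover have "S_set N K \<in> Den_l (SS N K) (aa N K)"
    unfolding S_set_SS by (rule denominators.in_Den_l[OF denominators_to_rat_of_mpoly])
  moreover have "T_set N K \<in> Den_l (SS N K) (aa N K)"
    unfolding T_set_SS by (rule denominators.in_Den_l[OF denominators_to_rat_nonzero])
  ultimately show ?thesis
    unfolding Yreg
    using YDen Yden algebra_iso_if_ratfun_coordinates[OF Q rat] algebra_iso_if_ratfun_coordinates[OF Y Q]
      algebra_iso_if_ratfun_coordinates[OF Y T] algebra_iso_if_ratfun_coordinates[OF T S]
      algebra_iso_if_ratfun_coordinates[OF S rat]
    by blast
qed

end
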